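(* Let $\mathscr{T}$ be a triangulated category with set indexed coproducts, with suspension functor $\Sigma$, and let $\mathscr{S}$ be a set of compact objects of $\mathscr{T}$ such that (1) $\mathrm{Hom}_{\mathscr{T}}(S,\Sigma^{i}S')=0$ for all $S,S'\in\mathscr{S}$ and all $i>0$; (2) $\{\Sigma^{i}S\mid i\in\mathbb{Z},\ S\in\mathscr{S}\}$ is a generating set for $\mathscr{T}$. Let $$\mathscr{B}=\{X\in\mathscr{T}\mid \mathrm{Hom}_{\mathscr{T}}(S,\Sigma^{n}X)=0 \text{ for all } S\in\mathscr{S} \text{ and } n>0\},\qquad \mathscr{A}=\Sigma({}^{\perp}\mathscr{B}),$$ and let $$\mathscr{X}=\{X\in\mathscr{T}\mid \mathrm{Hom}_{\mathscr{T}}(S,\Sigma^{i}X)=0 \text{ for all } S\in\mathscr{S},\ i>0\},$$ $$\mathscr{Y}=\{X\in\mathscr{T}\mid \mathrm{Hom}_{\mathscr{T}}(S,\Sigma^{i}X)=0 \text{ for all } S\in\mathscr{S},\ i<0\}.$$ Then the co-$t$-structure $(\mathscr{A},\mathscr{B})$ is left adjacent to the $t$-structure $(\mathscr{X},\mathscr{Y})$.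
   Context: An object $S$ of $\mathscr{T}$ is compact if for every set indexed family $\{X_i\}_{i\in I}$ of objects of $\mathscr{T}$ one has the natural isomorphism $\mathrm{Hom}_{\mathscr{T}}(S,\coprod_{i\in I}X_i)\cong\coprod_{i\in I}\mathrm{Hom}_{\mathscr{T}}(S,X_i)$. A set of objects $\mathscr{G}$ is a generating set for $\mathscr{T}$ if $\mathrm{Hom}_{\mathscr{T}}(G,X)=0$ for all $G\in\mathscr{G}$ implies $X=0$. For a full subcategory $\mathscr{B}$ of $\mathscr{T}$, ${}^{\perp}\mathscr{B}$ is the full subcategory of objects $X$ with $\mathrm{Hom}_{\mathscr{T}}(X,B)=0$ for all $B\in\mathscr{B}$, and $\Sigma({}^{\perp}\mathscr{B})$ is the full subcategory of objects $X$ with $\Sigma^{-1}X\in{}^{\perp}\mathscr{B}$. A pair $(\mathscr{A},\mathscr{B})$ of full subcategories of $\mathscr{T}$ is a co-$t$-structure on $\mathscr{T}$ if: (0) $\mathscr{A}$ and $\mathscr{B}$ are closed under direct summands; (1) $\Sigma^{-1}\mathscr{A}\subseteq\mathscr{A}$ and $\Sigma\mathscr{B}\subseteq\mathscr{B}$; (2) $\mathrm{Hom}_{\mathscr{T}}(\Sigma^{-1}A,B)=0$ for all $A\in\mathscr{A}$, $B\in\mathscr{B}$; (3) for every object $X$ of $\mathscr{T}$ there is a distinguished triangle $\Sigma^{-1}A\to X\to B\to A$ with $A\in\mathscr{A}$ and $B\in\mathscr{B}$. Convention for $t$-structures: a pair $(\mathscr{X},\mathscr{Y})$ of full subcategories (closed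 under isomorphism) is a $t$-structure if $\Sigma\mathscr{X}\subseteq\mathscr{X}$, $\Sigma^{-1}\mathscr{Y}\subseteq\mathscr{Y}$, $\mathrm{Hom}_{\mathscr{T}}(\Sigma X,Y)=0$ for all $X\in\mathscr{X}$, $Y\in\mathscr{Y}$, and every object $Z$ of $\mathscr{T}$ admits a distinguished triangle $\Sigma X\to Z\to Y\to\Sigma^{2}X$ with $X\in\mathscr{X}$, $Y\in\mathscr{Y}$. That the pair $(\mathscr{X},\mathscr{Y})$ in the claim is a $t$-structure under hypotheses (1) and (2) is a known result of Beligiannis and Reiten. A co-$t$-structure $(\mathscr{A},\mathscr{B})$ is called left adjacent to a $t$-structure $(\mathscr{X},\mathscr{Y})$ if $\mathscr{B}=\mathscr{X}$. *)

theory Defs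
  imports "HOL-Algebra.Product_Groups" "HOL-Algebra.FiniteProduct"
begin

section \<open>Sets of bounded size\<close>

text \<open>
  The objects of a triangulated category with set-indexed coproducts normally form a proper class,
  so ``set'' has to be told apart from ``class''.  Here every collection is a HOL set, and a type
  \<open>'u\<close> plays the part of the class of all sets: a small set is one of strictly smaller cardinality
  than \<open>'u\<close>.  The inequality must be strict: a category with coproducts indexed by all sets of
  the size of its collection of arrows is a preorder, and zero if it is additive.  The two closure
  properties required of \<open>'u\<close> say that countable sets are small and that a small union of small sets
  is small; any uncountable Grothendieck universe has them.

  That morphisms between two objects form a set, and not a proper class, is likewise a smallness
  condition, which has to be stated separately.  If it is imposed on all Hom sets, then a nonzero
  category with small coproducts exists only if \<open>'u\<close> is strongly inaccessible.  It is needed only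
  for the Hom sets out of the given compact objects, and in this form it can be satisfied without
  any large cardinal.
\<close>

definition small :: "'u itself \<Rightarrow> 'a set \<Rightarrow> bool" where
  "small U A \<longleftrightarrow> (card_of A, card_of (UNIV :: 'u set)) \<in> ordLess"

definition universe :: "'u itself \<Rightarrow> bool" where
  "universe U \<longleftrightarrow> small U (UNIV :: nat set) \<and> regularCard (card_of (UNIV :: 'u set))"


section \<open>Additive categories\<close>

text \<open>\<open>cmp T g f\<close> is the composite of \<open>f\<close> followed by \<open>g\<close>.\<close>

record ('o, 'm) tri_cat =
  obj :: "'o set"
  Hom :: "'o \<Rightarrow> 'o \<Rightarrow> 'm set"
  ident :: "'o \<Rightarrow> 'm"
  cmp :: "'m \<Rightarrow> 'm \<Rightarrow> 'm" (infixr "\<cdot>\<index>" 70)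
  zarr :: "'o \<Rightarrow> 'o \<Rightarrow> 'm"
  padd :: "'m \<Rightarrow> 'm \<Rightarrow> 'm"
  susp :: "'o \<Rightarrow> 'o"
  suspm :: "'m \<Rightarrow> 'm"
  tri :: "('m \<times> 'm \<times> 'm) set"

locale category =
  fixes T :: "('o, 'm) tri_cat" (structure)
  assumes Hom_obj: "f \<in> Hom T X Y \<Longrightarrow> X \<in> obj T \<and> Y \<in> obj T"
    and Hom_disjoint: "\<lbrakk>f \<in> Hom T X Y; f \<in> Hom T X' Y'\<rbrakk> \<Longrightarrow> X = X' \<and> Y = Y'"
    and ident_Hom: "X \<in> obj T \<Longrightarrow> ident T X \<in> Hom T X X"
    and cmp_Hom: "\<lbrakk>f \<in> Hom T X Y; g \<in> Hom T Y Z\<rbrakk> \<Longrightarrow> g \<cdot> f \<in> Hom T X Z"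
    and cmp_ident: "f \<in> Hom T X Y \<Longrightarrow> f \<cdot> ident T X = f"
    and ident_cmp: "f \<in> Hom T X Y \<Longrightarrow> ident T Y \<cdot> f = f"
    and cmp_assoc: "\<lbrakk>f \<in> Hom T X Y; g \<in> Hom T Y Z; h \<in> Hom T Z W\<rbrakk> \<Longrightarrow> (h \<cdot> g) \<cdot> f = h \<cdot> (g \<cdot> f)"

text \<open>The Hom groups are written multiplicatively, as instances of the library's group records.\<close>

definition hom_group :: "('o, 'm) tri_cat \<Rightarrow> 'o \<Rightarrow> 'o \<Rightarrow> 'm monoid" where
  "hom_group T X Y = \<lparr>carrier = Hom T X Y, monoid.mult = padd T, one = zarr T X Y\<rparr>"

definition is_zero :: "('o, 'm) tri_cat \<Rightarrow> 'o \<Rightarrow> bool" where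
  "is_zero T Z \<longleftrightarrow> Z \<in> obj T \<and>
     (\<forall>X \<in> obj T. (\<exists>!f. f \<in> Hom T X Z) \<and> (\<exists>!f. f \<in> Hom T Z X))"

definition is_iso :: "('o, 'm) tri_cat \<Rightarrow> 'o \<Rightarrow> 'o \<Rightarrow> 'm \<Rightarrow> bool" where
  "is_iso T X Y f \<longleftrightarrow> f \<in> Hom T X Y \<and>
     (\<exists>g \<in> Hom T Y X. cmp T g f = ident T X \<and> cmp T f g = ident T Y)"

definition is_biproduct ::
  "('o, 'm) tri_cat \<Rightarrow> 'o \<Rightarrow> 'o \<Rightarrow> 'o \<Rightarrow> 'm \<Rightarrow> 'm \<Rightarrow> 'm \<Rightarrow> 'm \<Rightarrow> bool" where
  "is_biproduct T X Y P i j p q \<longleftrightarrow>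
     i \<in> Hom T X P \<and> j \<in> Hom T Y P \<and> p \<in> Hom T P X \<and> q \<in> Hom T P Y \<and>
     cmp T p i = ident T X \<and> cmp T q j = ident T Y \<and>
     cmp T q i = zarr T X Y \<and> cmp T p j = zarr T Y X \<and>
     padd T (cmp T i p) (cmp T j q) = ident T P"

locale additive_category = category +
  assumes hom_comm_group: "\<lbrakk>X \<in> obj T; Y \<in> obj T\<rbrakk> \<Longrightarrow> comm_group (hom_group T X Y)"
    and cmp_padd_right: "\<lbrakk>f \<in> Hom T X Y; f' \<in> Hom T X Y; g \<in> Hom T Y Z\<rbrakk>
      \<Longrightarrow> g \<cdot> padd T f f' = padd T (g \<cdot> f) (g \<cdot> f')"
    and cmp_padd_left: "\<lbrakk>f \<in> Hom T X Y; g \<in> Hom T Y Z; g' \<in> Hom T Y Z\<rbrakk>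
      \<Longrightarrow> padd T g g' \<cdot> f = padd T (g \<cdot> f) (g' \<cdot> f)"
    and ex_zero: "\<exists>Z. is_zero T Z"
    and ex_biproduct: "\<lbrakk>X \<in> obj T; Y \<in> obj T\<rbrakk> \<Longrightarrow> \<exists>P i j p q. is_biproduct T X Y P i j p q"


section \<open>Triangulated categories\<close>

definition distinguished ::
  "('o, 'm) tri_cat \<Rightarrow> 'o \<Rightarrow> 'o \<Rightarrow> 'o \<Rightarrow> 'm \<Rightarrow> 'm \<Rightarrow> 'm \<Rightarrow> bool" where
  "distinguished T X Y Z u v w \<longleftrightarrow>
     u \<in> Hom T X Y \<and> v \<in> Hom T Y Z \<and> w \<in> Hom T Z (susp T X) \<and> (u, v, w) \<in> tri T"

text \<open>
  The suspension is an additive automorphism of the category, so that its negative powers are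
  available strictly.  The assumptions on triangles are Verdier's axioms TR1 (three clauses),
  TR2, TR3 and the octahedral axiom TR4.
\<close>

locale triangulated_category = additive_category +
  assumes susp_bij: "bij_betw (susp T) (obj T) (obj T)"
    and suspm_bij: "\<lbrakk>X \<in> obj T; Y \<in> obj T\<rbrakk>
      \<Longrightarrow> bij_betw (suspm T) (Hom T X Y) (Hom T (susp T X) (susp T Y))"
    and suspm_ident: "X \<in> obj T \<Longrightarrow> suspm T (ident T X) = ident T (susp T X)"
    and suspm_cmp: "\<lbrakk>f \<in> Hom T X Y; g \<in> Hom T Y Z\<rbrakk> \<Longrightarrow> suspm T (g \<cdot> f) = suspm T g \<cdot> suspm T f"
    and suspm_padd: "\<lbrakk>f \<in> Hom T X Y; g \<in> Hom T X Y\<rbrakk>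
      \<Longrightarrow> suspm T (padd T f g) = padd T (suspm T f) (suspm T g)"
    and TR1_iso: "\<lbrakk>distinguished T X Y Z u v w;
        u' \<in> Hom T X' Y'; v' \<in> Hom T Y' Z'; w' \<in> Hom T Z' (susp T X');
        is_iso T X X' a; is_iso T Y Y' b; is_iso T Z Z' c;
        b \<cdot> u = u' \<cdot> a; c \<cdot> v = v' \<cdot> b; suspm T a \<cdot> w = w' \<cdot> c\<rbrakk>
      \<Longrightarrow> distinguished T X' Y' Z' u' v' w'"
    and TR1_ident: "\<lbrakk>X \<in> obj T; is_zero T Z\<rbrakk>
      \<Longrightarrow> distinguished T X X Z (ident T X) (zarr T X Z) (zarr T Z (susp T X))"
    and TR1_cone: "u \<in> Hom T X Y \<Longrightarrow> \<exists>Z v w. distinguished T X Y Z u v w"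
    and TR2: "\<lbrakk>u \<in> Hom T X Y; v \<in> Hom T Y Z; w \<in> Hom T Z (susp T X)\<rbrakk>
      \<Longrightarrow> distinguished T X Y Z u v w \<longleftrightarrow>
          distinguished T Y Z (susp T X) v w (inv\<^bsub>hom_group T (susp T X) (susp T Y)\<^esub> (suspm T u))"
    and TR3: "\<lbrakk>distinguished T X Y Z u v w; distinguished T X' Y' Z' u' v' w';
        a \<in> Hom T X X'; b \<in> Hom T Y Y'; b \<cdot> u = u' \<cdot> a\<rbrakk>
      \<Longrightarrow> \<exists>c \<in> Hom T Z Z'. c \<cdot> v = v' \<cdot> b \<and> suspm T a \<cdot> w = w' \<cdot> c"
    and TR4: "\<lbrakk>distinguished T X Y Z' u j k; distinguished T Y Z X' v l i;
        distinguished T X Z Y' (v \<cdot> u) m n\<rbrakk>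
      \<Longrightarrow> \<exists>f g. distinguished T Z' Y' X' f g (suspm T j \<cdot> i) \<and>
            f \<cdot> j = m \<cdot> v \<and> n \<cdot> f = k \<and> g \<cdot> m = l \<and> i \<cdot> g = suspm T u \<cdot> n"

definition unsusp :: "('o, 'm) tri_cat \<Rightarrow> 'o \<Rightarrow> 'o" where
  "unsusp T = inv_into (obj T) (susp T)"

definition shift :: "('o, 'm) tri_cat \<Rightarrow> int \<Rightarrow> 'o \<Rightarrow> 'o" where
  "shift T n X = (if 0 \<le> n then (susp T ^^ nat n) X else (unsusp T ^^ nat (- n)) X)"

definition hom_vanishes :: "('o, 'm) tri_cat \<Rightarrow> 'o \<Rightarrow> 'o \<Rightarrow> bool" where
  "hom_vanishes T X Y \<longleftrightarrow> Hom T X Y = {zarr T X Y}"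


section \<open>Coproducts, compact objects and generators\<close>

definition is_coproduct ::
  "('o, 'm) tri_cat \<Rightarrow> 'i set \<Rightarrow> ('i \<Rightarrow> 'o) \<Rightarrow> 'o \<Rightarrow> ('i \<Rightarrow> 'm) \<Rightarrow> bool" where
  "is_coproduct T I X P \<iota> \<longleftrightarrow> P \<in> obj T \<and> (\<forall>i \<in> I. \<iota> i \<in> Hom T (X i) P) \<and>
     (\<forall>Z \<in> obj T. \<forall>f. (\<forall>i \<in> I. f i \<in> Hom T (X i) Z) \<longrightarrow>
       (\<exists>!h. h \<in> Hom T P Z \<and> (\<forall>i \<in> I. cmp T h (\<iota> i) = f i)))"

text \<open>
  Every small set is equipotent to a subset of \<open>'u\<close>, so it is enough to consider families
  indexed by small subsets of \<open>'u\<close>.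
\<close>

definition has_small_coproducts :: "'u itself \<Rightarrow> ('o, 'm) tri_cat \<Rightarrow> bool" where
  "has_small_coproducts U T \<longleftrightarrow>
     (\<forall>(I :: 'u set) X. small U I \<and> X ` I \<subseteq> obj T \<longrightarrow> (\<exists>P \<iota>. is_coproduct T I X P \<iota>))"

text \<open>The canonical map from the direct sum of the groups \<open>Hom(S, X i)\<close> to \<open>Hom(S, P)\<close>.\<close>

definition coproduct_comparison ::
  "('o, 'm) tri_cat \<Rightarrow> 'o \<Rightarrow> 'i set \<Rightarrow> ('i \<Rightarrow> 'o) \<Rightarrow> 'o \<Rightarrow> ('i \<Rightarrow> 'm) \<Rightarrow> ('i \<Rightarrow> 'm) \<Rightarrow> 'm" where
  "coproduct_comparison T S I X P \<iota> f =
     finprod (hom_group T S P) (\<lambda>i. cmp T (\<iota> i) (f i)) {i \<in> I. f i \<noteq> zarr T S (X i)}"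

definition compact_object :: "'u itself \<Rightarrow> ('o, 'm) tri_cat \<Rightarrow> 'o \<Rightarrow> bool" where
  "compact_object U T S \<longleftrightarrow> S \<in> obj T \<and>
     (\<forall>(I :: 'u set) X P \<iota>. small U I \<and> X ` I \<subseteq> obj T \<and> is_coproduct T I X P \<iota> \<longrightarrow>
       coproduct_comparison T S I X P \<iota>
         \<in> iso (sum_group I (\<lambda>i. hom_group T S (X i))) (hom_group T S P))"

definition generating_set :: "'u itself \<Rightarrow> ('o, 'm) tri_cat \<Rightarrow> 'o set \<Rightarrow> bool" where
  "generating_set U T \<G> \<longleftrightarrow> small U \<G> \<and> \<G> \<subseteq> obj T \<and>
     (\<forall>X \<in> obj T. (\<forall>G \<in> \<G>. hom_vanishes T G X) \<longrightarrow> is_zero T X)"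


section \<open>t-structures and co-t-structures\<close>

text \<open>A full subcategory is given by its set of objects.\<close>

definition left_perp :: "('o, 'm) tri_cat \<Rightarrow> 'o set \<Rightarrow> 'o set" where
  "left_perp T \<B> = {X \<in> obj T. \<forall>B \<in> \<B>. hom_vanishes T X B}"

definition susp_subcat :: "('o, 'm) tri_cat \<Rightarrow> 'o set \<Rightarrow> 'o set" where
  "susp_subcat T \<C> = {X \<in> obj T. unsusp T X \<in> \<C>}"

definition iso_closed :: "('o, 'm) tri_cat \<Rightarrow> 'o set \<Rightarrow> bool" where
  "iso_closed T \<C> \<longleftrightarrow> (\<forall>X \<in> \<C>. \<forall>Y f. is_iso T X Y f \<longrightarrow> Y \<in> \<C>)"

definition summand_closed :: "('o, 'm) tri_cat \<Rightarrow> 'o set \<Rightarrow> bool" where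
  "summand_closed T \<C> \<longleftrightarrow> (\<forall>P \<in> \<C>. \<forall>X Y i j p q. is_biproduct T X Y P i j p q \<longrightarrow> X \<in> \<C>)"

definition co_t_structure :: "('o, 'm) tri_cat \<Rightarrow> 'o set \<Rightarrow> 'o set \<Rightarrow> bool" where
  "co_t_structure T \<A> \<B> \<longleftrightarrow> \<A> \<subseteq> obj T \<and> \<B> \<subseteq> obj T \<and>
     summand_closed T \<A> \<and> summand_closed T \<B> \<and>
     unsusp T ` \<A> \<subseteq> \<A> \<and> susp T ` \<B> \<subseteq> \<B> \<and>
     (\<forall>A \<in> \<A>. \<forall>B \<in> \<B>. hom_vanishes T (unsusp T A) B) \<and>
     (\<forall>X \<in> obj T. \<exists>A \<in> \<A>. \<exists>B \<in> \<B>. \<exists>u v w. w \<in> Hom T B A \<and>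
       distinguished T (unsusp T A) X B u v w)"

definition t_structure :: "('o, 'm) tri_cat \<Rightarrow> 'o set \<Rightarrow> 'o set \<Rightarrow> bool" where
  "t_structure T \<X> \<Y> \<longleftrightarrow> \<X> \<subseteq> obj T \<and> \<Y> \<subseteq> obj T \<and>
     iso_closed T \<X> \<and> iso_closed T \<Y> \<and>
     susp T ` \<X> \<subseteq> \<X> \<and> unsusp T ` \<Y> \<subseteq> \<Y> \<and>
     (\<forall>X \<in> \<X>. \<forall>Y \<in> \<Y>. hom_vanishes T (susp T X) Y) \<and>
     (\<forall>Z \<in> obj T. \<exists>X \<in> \<X>. \<exists>Y \<in> \<Y>. \<exists>u v w. distinguished T (susp T X) Z Y u v w)"

definition left_adjacent ::
  "('o, 'm) tri_cat \<Rightarrow> 'o set \<times> 'o set \<Rightarrow> 'o set \<times> 'o set \<Rightarrow> bool" where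
  "left_adjacent T = (\<lambda>(\<A>, \<B>) (\<X>, \<Y>). co_t_structure T \<A> \<B> \<and> t_structure T \<X> \<Y> \<and> \<B> = \<X>)"

end

theory Submission
  imports Defs
begin

text \<open>
  A small set \<open>\<G>\<close> of compact objects generates a torsion pair: starting from \<open>X\<close>, take repeatedly
  the cone of the canonical map from the coproduct of all \<open>G \<rightarrow> X\<close> with \<open>G \<in> \<G>\<close>, and pass to the
  homotopy colimit \<open>Q\<close>.  Compactness gives \<open>Q \<in> \<G>\<^sup>\<bottom>\<close>; the fibre \<open>F\<close> of \<open>X \<rightarrow> Q\<close> is left orthogonal to
  \<open>\<G>\<^sup>\<bottom>\<close>, because the \<open>lim\<^sup>1\<close> terms vanish, and a compact object without nonzero maps to \<open>\<G>\<close>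
  has no nonzero map to \<open>F\<close>.  The negative shifts of \<open>\<S>\<close> give the co-t-structure.  The positive shifts
  give the t-structure; there hypotheses (1) and (2) are needed to identify the left orthogonal of
  \<open>\<Y>\<close> with \<open>\<Sigma>\<X>\<close>.
\<close>

section \<open>Additive categories\<close>

text \<open>Triangles provide only weak kernels and weak cokernels, so neither cones nor homotopy
  colimits are functorial. For this reason \<open>F\<close> is never presented as a colimit of
  iterated extensions of coproducts from \<open>\<G>\<close>; all its properties are read off the
  map \<open>X \<rightarrow> Q\<close>. A map out of \<open>F\<close> is controlled by the
  obstruction to extending it to \<open>X\<close>, a map into \<open>F\<close> by injectivity of
  \<open>Hom(S, X) \<rightarrow> Hom(S, Q)\<close> and surjectivity of
  \<open>Hom(\<Sigma>S, X) \<rightarrow> Hom(\<Sigma>S, Q)\<close>. One cone does not suffice to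
  make the target orthogonal to \<open>\<G>\<close>: it kills the given maps but may create new
  ones. Countably many steps do, because a map from a compact object to \<open>Q\<close> already
  comes from some stage and dies at the next. The two applications differ. \<open>\<B>\<close> is
  itself the right half of a torsion pair, and its partner is a left orthogonal by definition. In
  the t-structure the right half is \<open>\<Y>\<close>, whereas \<open>\<X>\<close> is again
  defined by maps out of \<open>\<S>\<close>; comparing it with a left orthogonal is the real
  content there.\<close>

lemma hom_group_simps [simp]:
  "carrier (hom_group T X Y) = Hom T X Y"
  "monoid.mult (hom_group T X Y) = padd T"
  "one (hom_group T X Y) = zarr T X Y"
  by (simp_all add: hom_group_def)

context additive_category
begin

abbreviation neg :: "'a \<Rightarrow> 'a \<Rightarrow> 'b \<Rightarrow> 'b" where
  "neg X Y f \<equiv> inv\<^bsub>hom_group T X Y\<^esub> f"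

lemma Hom_source: "f \<in> Hom T X Y \<Longrightarrow> X \<in> obj T"
  and Hom_target: "f \<in> Hom T X Y \<Longrightarrow> Y \<in> obj T"
  using Hom_obj by blast+

lemma zarr_Hom: "X \<in> obj T \<Longrightarrow> Y \<in> obj T \<Longrightarrow> zarr T X Y \<in> Hom T X Y"
  using monoid.one_closed[OF comm_monoid.axioms(1)[OF comm_group.axioms(1)[OF hom_comm_group]]]
  by fastforce

lemma padd_Hom:
  assumes "f \<in> Hom T X Y" "g \<in> Hom T X Y"
  shows "padd T f g \<in> Hom T X Y"
proof -
  interpret comm_group "hom_group T X Y"
    using assms by (intro hom_comm_group) (auto dest: Hom_obj)
  show ?thesis using m_closed[of f g] assms by simp
qed

lemma neg_Hom:
  assumes "f \<in> Hom T X Y"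
  shows "neg X Y f \<in> Hom T X Y"
proof -
  interpret comm_group "hom_group T X Y"
    using assms by (intro hom_comm_group) (auto dest: Hom_obj)
  show ?thesis using inv_closed[of f] assms by simp
qed

lemma padd_assoc:
  assumes "f \<in> Hom T X Y" "g \<in> Hom T X Y" "h \<in> Hom T X Y"
  shows "padd T (padd T f g) h = padd T f (padd T g h)"
proof -
  interpret comm_group "hom_group T X Y"
    using assms by (intro hom_comm_group) (auto dest: Hom_obj)
  show ?thesis using m_assoc[of f g h] assms by simp
qed

lemma padd_zarr:
  assumes "f \<in> Hom T X Y"
  shows "padd T f (zarr T X Y) = f" "padd T (zarr T X Y) f = f"
proof -
  interpret comm_group "hom_group T X Y"
    using assms by (intro hom_comm_group) (auto dest: Hom_obj)
  show "padd T f (zarr T X Y) = f" "padd T (zarr T X Y) f = f"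
    using r_one[of f] l_one[of f] assms by simp_all
qed

lemma padd_neg:
  assumes "f \<in> Hom T X Y"
  shows "padd T f (neg X Y f) = zarr T X Y" "padd T (neg X Y f) f = zarr T X Y"
proof -
  interpret comm_group "hom_group T X Y"
    using assms by (intro hom_comm_group) (auto dest: Hom_obj)
  show "padd T f (neg X Y f) = zarr T X Y" "padd T (neg X Y f) f = zarr T X Y"
    using r_inv[of f] l_inv[of f] assms by simp_all
qed

lemma padd_cancel_right:
  assumes "f \<in> Hom T X Y" "g \<in> Hom T X Y" "h \<in> Hom T X Y"
  shows "padd T f h = padd T g h \<longleftrightarrow> f = g"
proof -
  interpret comm_group "hom_group T X Y"
    using assms by (intro hom_comm_group) (auto dest: Hom_obj)
  show ?thesis using right_cancel[of h f g] assms by simp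
qed

text \<open>Applied to the image of a zero morphism under an additive operation; this is how
  composition and suspension are seen to preserve zero morphisms.\<close>

lemma padd_idem_zero:
  assumes "f \<in> Hom T X Y" "padd T f f = f"
  shows "f = zarr T X Y"
  using padd_cancel_right[of f X Y "zarr T X Y" f] assms padd_zarr[OF assms(1)]
    zarr_Hom[OF Hom_source[OF assms(1)] Hom_target[OF assms(1)]] by simp

lemma neg_unique:
  assumes "f \<in> Hom T X Y" "g \<in> Hom T X Y" "padd T g f = zarr T X Y"
  shows "g = neg X Y f"
  using padd_cancel_right[of g X Y "neg X Y f" f] assms padd_neg neg_Hom by simp

lemma neg_eq_iff:
  assumes "f \<in> Hom T X Y" "g \<in> Hom T X Y"
  shows "neg X Y f = neg X Y g \<longleftrightarrow> f = g"
proof -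
  interpret comm_group "hom_group T X Y"
    using assms by (intro hom_comm_group) (auto dest: Hom_obj)
  show ?thesis using inv_inv[of f] inv_inv[of g] assms hom_group_simps(1) by metis
qed

lemma neg_zarr: "X \<in> obj T \<Longrightarrow> Y \<in> obj T \<Longrightarrow> neg X Y (zarr T X Y) = zarr T X Y"
  using neg_unique[of "zarr T X Y" X Y "zarr T X Y"] zarr_Hom[of X Y] padd_zarr by simp

lemma cmp_zarr:
  assumes "g \<in> Hom T Y Z" "X \<in> obj T"
  shows "g \<cdot> zarr T X Y = zarr T X Z"
proof (rule padd_idem_zero)
  have z: "zarr T X Y \<in> Hom T X Y" using assms zarr_Hom Hom_source by blast
  show "g \<cdot> zarr T X Y \<in> Hom T X Z" using z assms cmp_Hom by blast
  show "padd T (g \<cdot> zarr T X Y) (g \<cdot> zarr T X Y) = g \<cdot> zarr T X Y"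
    using cmp_padd_right[OF z z assms(1)] padd_zarr[OF z] by simp
qed

lemma zarr_cmp:
  assumes "f \<in> Hom T X Y" "Z \<in> obj T"
  shows "zarr T Y Z \<cdot> f = zarr T X Z"
proof (rule padd_idem_zero)
  have z: "zarr T Y Z \<in> Hom T Y Z" using assms zarr_Hom Hom_target by blast
  show "zarr T Y Z \<cdot> f \<in> Hom T X Z" using z assms cmp_Hom by blast
  show "padd T (zarr T Y Z \<cdot> f) (zarr T Y Z \<cdot> f) = zarr T Y Z \<cdot> f"
    using cmp_padd_left[OF assms(1) z z] padd_zarr[OF z] by simp
qed

lemma cmp_neg:
  assumes "f \<in> Hom T X Y" "g \<in> Hom T Y Z"
  shows "g \<cdot> neg X Y f = neg X Z (g \<cdot> f)"
proof (rule neg_unique)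
  show "g \<cdot> f \<in> Hom T X Z" "g \<cdot> neg X Y f \<in> Hom T X Z"
    using assms cmp_Hom neg_Hom by blast+
  show "padd T (g \<cdot> neg X Y f) (g \<cdot> f) = zarr T X Z"
    using cmp_padd_right[OF neg_Hom[OF assms(1)] assms] padd_neg[OF assms(1)]
      cmp_zarr[OF assms(2) Hom_source[OF assms(1)]] by simp
qed

lemma neg_cmp:
  assumes "f \<in> Hom T X Y" "g \<in> Hom T Y Z"
  shows "neg Y Z g \<cdot> f = neg X Z (g \<cdot> f)"
proof (rule neg_unique)
  show "g \<cdot> f \<in> Hom T X Z" "neg Y Z g \<cdot> f \<in> Hom T X Z"
    using assms cmp_Hom neg_Hom by blast+
  show "padd T (neg Y Z g \<cdot> f) (g \<cdot> f) = zarr T X Z"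
    using cmp_padd_left[OF assms(1) neg_Hom[OF assms(2)] assms(2)] padd_neg[OF assms(2)]
      zarr_cmp[OF assms(1) Hom_target[OF assms(2)]] by simp
qed

lemma hom_vanishes_iff:
  assumes "X \<in> obj T" "Y \<in> obj T"
  shows "hom_vanishes T X Y \<longleftrightarrow> (\<forall>f \<in> Hom T X Y. f = zarr T X Y)"
  unfolding hom_vanishes_def using zarr_Hom[OF assms] by blast

lemma hom_vanishesD: "hom_vanishes T X Y \<Longrightarrow> f \<in> Hom T X Y \<Longrightarrow> f = zarr T X Y"
  unfolding hom_vanishes_def by blast

lemma zero_object_Hom:
  assumes "is_zero T Z"
  shows "f \<in> Hom T X Z \<Longrightarrow> f = zarr T X Z" "f \<in> Hom T Z X \<Longrightarrow> f = zarr T Z X"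
proof -
  have Z: "Z \<in> obj T"
    and u: "\<And>X. X \<in> obj T \<Longrightarrow> (\<exists>!f. f \<in> Hom T X Z) \<and> (\<exists>!f. f \<in> Hom T Z X)"
    using assms unfolding is_zero_def by auto
  show "f = zarr T X Z" if "f \<in> Hom T X Z"
    using that u[OF Hom_source[OF that]] zarr_Hom[OF Hom_source[OF that] Z] by blast
  show "f = zarr T Z X" if "f \<in> Hom T Z X"
    using that u[OF Hom_target[OF that]] zarr_Hom[OF Z Hom_target[OF that]] by blast
qed

lemma is_zeroI:
  assumes Z: "Z \<in> obj T" and id0: "ident T Z = zarr T Z Z"
  shows "is_zero T Z"
proof -
  have "f = zarr T X Z" if f: "f \<in> Hom T X Z" for f X
    using ident_cmp[OF f] zarr_cmp[OF f Z] id0 by simp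
  moreover have "f = zarr T Z X" if f: "f \<in> Hom T Z X" for f X
    using cmp_ident[OF f] cmp_zarr[OF f Z] id0 by simp
  ultimately show ?thesis
    unfolding is_zero_def using Z zarr_Hom by metis
qed

end


section \<open>Triangulated categories\<close>

lemma distinguishedD:
  assumes "distinguished T X Y Z u v w"
  shows "u \<in> Hom T X Y" "v \<in> Hom T Y Z" "w \<in> Hom T Z (susp T X)"
  using assms unfolding distinguished_def by auto

context triangulated_category
begin

section \<open>The suspension as an automorphism\<close>

lemma susp_obj: "X \<in> obj T \<Longrightarrow> susp T X \<in> obj T"
  using susp_bij bij_betwE by blast

lemma unsusp_obj: "X \<in> obj T \<Longrightarrow> unsusp T X \<in> obj T"
  unfolding unsusp_def using susp_bij by (metis bij_betw_def inv_into_into)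

lemma susp_unsusp: "X \<in> obj T \<Longrightarrow> susp T (unsusp T X) = X"
  unfolding unsusp_def using susp_bij by (metis bij_betw_inv_into_right)

lemma unsusp_susp: "X \<in> obj T \<Longrightarrow> unsusp T (susp T X) = X"
  unfolding unsusp_def using susp_bij by (metis bij_betw_inv_into_left)

lemma suspm_Hom: "f \<in> Hom T X Y \<Longrightarrow> suspm T f \<in> Hom T (susp T X) (susp T Y)"
  using suspm_bij[of X Y] Hom_obj[of f X Y] bij_betwE by blast

lemma suspm_inj: "f \<in> Hom T X Y \<Longrightarrow> g \<in> Hom T X Y \<Longrightarrow> suspm T f = suspm T g \<longleftrightarrow> f = g"
  using suspm_bij[of X Y] Hom_obj[of f X Y] by (metis bij_betw_def inj_on_def)

lemma suspm_surj:
  assumes "g \<in> Hom T (susp T X) (susp T Y)" "X \<in> obj T" "Y \<in> obj T"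
  obtains f where "f \<in> Hom T X Y" "suspm T f = g"
  using suspm_bij[of X Y] assms by (metis bij_betw_def imageE)

lemma suspm_zarr:
  assumes "X \<in> obj T" "Y \<in> obj T"
  shows "suspm T (zarr T X Y) = zarr T (susp T X) (susp T Y)"
  using padd_idem_zero[OF suspm_Hom[OF zarr_Hom[OF assms]]]
    suspm_padd[OF zarr_Hom[OF assms] zarr_Hom[OF assms]] padd_zarr[OF zarr_Hom[OF assms]] by simp

lemma suspm_eq_zarr:
  assumes "f \<in> Hom T X Y"
  shows "suspm T f = zarr T (susp T X) (susp T Y) \<longleftrightarrow> f = zarr T X Y"
  using suspm_inj[OF assms zarr_Hom[OF Hom_source[OF assms] Hom_target[OF assms]]]
    suspm_zarr[OF Hom_source[OF assms] Hom_target[OF assms]] by simp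

lemma is_zero_susp:
  assumes "is_zero T Z"
  shows "is_zero T (susp T Z)"
proof -
  have Z: "Z \<in> obj T" using assms unfolding is_zero_def by simp
  have "ident T Z = zarr T Z Z" using zero_object_Hom[OF assms] ident_Hom[OF Z] by blast
  then show ?thesis
    using is_zeroI[OF susp_obj[OF Z]] suspm_ident[OF Z] suspm_zarr[OF Z Z] by simp
qed

lemma hom_vanishes_susp:
  assumes "X \<in> obj T" "Y \<in> obj T"
  shows "hom_vanishes T (susp T X) (susp T Y) \<longleftrightarrow> hom_vanishes T X Y"
  unfolding hom_vanishes_iff[OF assms] hom_vanishes_iff[OF susp_obj[OF assms(1)] susp_obj[OF assms(2)]]
  using suspm_eq_zarr suspm_Hom suspm_surj[OF _ assms] by metis

section \<open>Exactness of Hom on triangles, and fibres\<close>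

lemma rotate:
  assumes "distinguished T X Y Z u v w"
  shows "distinguished T Y Z (susp T X) v w (neg (susp T X) (susp T Y) (suspm T u))"
  using TR2[OF distinguishedD[OF assms]] assms by simp

text \<open>TR3 compares the once rotated identity triangle of \<open>A\<close> with the rotated
  given triangle. The filler is a map between suspensions, where the two signs caused by the
  rotations cancel, and is then desuspended.\<close>

lemma weak_kernel:
  assumes t: "distinguished T X Y Z u v w" and f: "f \<in> Hom T A Y" and vf: "v \<cdot> f = zarr T A Z"
  obtains g where "g \<in> Hom T A X" "u \<cdot> g = f"
proof -
  note u = distinguishedD(1)[OF t] and v = distinguishedD(2)[OF t] and w = distinguishedD(3)[OF t]
  obtain N where N: "is_zero T N" using ex_zero by blast
  then have No: "N \<in> obj T" unfolding is_zero_def by simp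
  have A: "A \<in> obj T" using f Hom_source by blast
  have X: "X \<in> obj T" using u Hom_source by blast
  have Z: "Z \<in> obj T" using v Hom_target by blast
  note r = rotate[OF TR1_ident[OF A N]]
  have "zarr T N Z \<cdot> zarr T A N = v \<cdot> f"
    using vf cmp_zarr[OF zarr_Hom[OF No Z] A] by simp
  then obtain c where c: "c \<in> Hom T (susp T A) (susp T X)"
    and eq: "suspm T f \<cdot> neg (susp T A) (susp T A) (suspm T (ident T A))
      = neg (susp T X) (susp T Y) (suspm T u) \<cdot> c"
    using TR3[OF r rotate[OF t] f zarr_Hom[OF No Z]] by blast
  have "suspm T f \<cdot> neg (susp T A) (susp T A) (suspm T (ident T A))
      = neg (susp T A) (susp T Y) (suspm T f)"
    using cmp_neg[OF suspm_Hom[OF ident_Hom[OF A]] suspm_Hom[OF f]]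
      suspm_cmp[OF ident_Hom[OF A] f] cmp_ident[OF f] by simp
  moreover have "neg (susp T X) (susp T Y) (suspm T u) \<cdot> c = neg (susp T A) (susp T Y) (suspm T u \<cdot> c)"
    by (rule neg_cmp[OF c suspm_Hom[OF u]])
  ultimately have eq': "suspm T f = suspm T u \<cdot> c"
    using eq neg_eq_iff[OF suspm_Hom[OF f] cmp_Hom[OF c suspm_Hom[OF u]]] by simp
  obtain g where g: "g \<in> Hom T A X" "suspm T g = c" using suspm_surj[OF c A X] by blast
  then have "suspm T (u \<cdot> g) = suspm T f" using eq' suspm_cmp[OF g(1) u] by simp
  then have "u \<cdot> g = f" using suspm_inj[OF cmp_Hom[OF g(1) u] f] by simp
  then show thesis using that g by blast
qed

text \<open>TR3 maps the given triangle to the triangle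
  \<open>0 \<rightarrow> A \<rightarrow> A\<close>, with \<open>f\<close> in the middle.\<close>

lemma weak_cokernel:
  assumes t: "distinguished T X Y Z u v w" and f: "f \<in> Hom T Y A" and fu: "f \<cdot> u = zarr T X A"
  obtains g where "g \<in> Hom T Z A" "g \<cdot> v = f"
proof -
  note u = distinguishedD(1)[OF t]
  obtain N where N: "is_zero T N" using ex_zero by blast
  then have No: "N \<in> obj T" unfolding is_zero_def by simp
  have A: "A \<in> obj T" using f Hom_target by blast
  have X: "X \<in> obj T" using u Hom_source by blast
  have SN: "susp T N \<in> obj T" using No susp_obj by simp
  \<comment> \<open>TR2 can be read backwards only if the third object is a suspension, so the zero
    object is taken to be \<open>susp T N\<close>.\<close>
  have "distinguished T A A (susp T N) (ident T A) (zarr T A (susp T N))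
      (neg (susp T N) (susp T A) (suspm T (zarr T N A)))"
    using TR1_ident[OF A is_zero_susp[OF N]] suspm_zarr[OF No A] neg_zarr[OF SN susp_obj[OF A]] by simp
  then have s: "distinguished T N A A (zarr T N A) (ident T A) (zarr T A (susp T N))"
    using TR2[OF zarr_Hom[OF No A] ident_Hom[OF A] zarr_Hom[OF A SN]] by simp
  have "f \<cdot> u = zarr T N A \<cdot> zarr T X N"
    using fu cmp_zarr[OF zarr_Hom[OF No A] X] by simp
  then obtain c where "c \<in> Hom T Z A" "c \<cdot> v = ident T A \<cdot> f"
    using TR3[OF t s zarr_Hom[OF X No] f] by blast
  then show thesis using that ident_cmp[OF f] by simp
qed

text \<open>The identity triangle of \<open>X\<close> maps to the given one, so
  \<open>v \<cdot> u\<close> factors through a zero object.\<close>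

lemma triangle_comp_zero:
  assumes t: "distinguished T X Y Z u v w"
  shows "v \<cdot> u = zarr T X Z"
proof -
  note u = distinguishedD(1)[OF t]
  have X: "X \<in> obj T" using u Hom_source by blast
  obtain N where N: "is_zero T N" using ex_zero by blast
  obtain c where c: "c \<in> Hom T N Z" "c \<cdot> zarr T X N = v \<cdot> u"
    using TR3[OF TR1_ident[OF X N] t ident_Hom[OF X] u refl] by blast
  then show ?thesis using cmp_zarr[OF c(1) X] by simp
qed

lemma triangle_comp_zero':
  assumes t: "distinguished T X Y Z u v w"
  shows "suspm T u \<cdot> w = zarr T Z (susp T Y)"
proof -
  note u = distinguishedD(1)[OF t] and w = distinguishedD(3)[OF t]
  have Z: "Z \<in> obj T" using w Hom_source by blast
  have SY: "susp T Y \<in> obj T" using suspm_Hom[OF u] Hom_target by blast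
  have "neg (susp T X) (susp T Y) (suspm T u) \<cdot> w = zarr T Z (susp T Y)"
    using triangle_comp_zero[OF rotate[OF rotate[OF t]]] .
  then show ?thesis
    using neg_cmp[OF w suspm_Hom[OF u]] neg_zarr[OF Z SY]
      neg_eq_iff[OF cmp_Hom[OF w suspm_Hom[OF u]] zarr_Hom[OF Z SY]] by simp
qed

lemma weak_kernel':
  assumes t: "distinguished T X Y Z u v w"
    and f: "f \<in> Hom T A (susp T X)" and uf: "suspm T u \<cdot> f = zarr T A (susp T Y)"
  obtains g where "g \<in> Hom T A Z" "w \<cdot> g = f"
proof -
  note u = distinguishedD(1)[OF t]
  have "neg (susp T X) (susp T Y) (suspm T u) \<cdot> f = zarr T A (susp T Y)"
    using neg_cmp[OF f suspm_Hom[OF u]] uf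
      neg_zarr[OF Hom_source[OF f] Hom_target[OF suspm_Hom[OF u]]] by simp
  then show thesis using weak_kernel[OF rotate[OF rotate[OF t]] f] that by blast
qed

text \<open>The composite \<open>suspm T f \<cdot> w\<close> is the obstruction to extending
  \<open>f\<close> along \<open>u\<close>. The sign of the rotated triangle is moved to the
  extension before it is desuspended.\<close>

lemma weak_cokernel':
  assumes t: "distinguished T X Y Z u v w"
    and f: "f \<in> Hom T X A" and fw: "suspm T f \<cdot> w = zarr T Z (susp T A)"
  obtains g where "g \<in> Hom T Y A" "g \<cdot> u = f"
proof -
  note u = distinguishedD(1)[OF t]
  have Y: "Y \<in> obj T" and A: "A \<in> obj T" using u f Hom_target by blast+
  obtain g where g: "g \<in> Hom T (susp T Y) (susp T A)"
    "g \<cdot> neg (susp T X) (susp T Y) (suspm T u) = suspm T f"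
    using weak_cokernel[OF rotate[OF rotate[OF t]] suspm_Hom[OF f] fw] by blast
  then have eq: "neg (susp T Y) (susp T A) g \<cdot> suspm T u = suspm T f"
    using neg_cmp[OF suspm_Hom[OF u] g(1)] cmp_neg[OF suspm_Hom[OF u] g(1)] by simp
  obtain h where h: "h \<in> Hom T Y A" "suspm T h = neg (susp T Y) (susp T A) g"
    using suspm_surj[OF neg_Hom[OF g(1)] Y A] by blast
  then have "h \<cdot> u = f"
    using eq suspm_cmp[OF u h(1)] suspm_inj[OF cmp_Hom[OF u h(1)] f] by simp
  then show thesis using that h by blast
qed

text \<open>The fibre is a desuspended cone. The third map of the cone triangle is the suspension of
  the wanted \<open>u\<close> up to the sign that TR2 introduces.\<close>

lemma ex_fibre:
  assumes "v \<in> Hom T Y Z"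
  obtains F u w where "distinguished T F Y Z u v w"
proof -
  obtain C c k where t: "distinguished T Y Z C v c k" using TR1_cone[OF assms] by blast
  note c = distinguishedD(2)[OF t] and k = distinguishedD(3)[OF t]
  have C: "C \<in> obj T" and Y: "Y \<in> obj T" using c assms Hom_target Hom_source by blast+
  define F where "F = unsusp T C"
  have F: "F \<in> obj T" "susp T F = C" unfolding F_def using C unsusp_obj susp_unsusp by auto
  have k': "k \<in> Hom T (susp T F) (susp T Y)" using k F by simp
  obtain u where u: "u \<in> Hom T F Y" "suspm T u = neg (susp T F) (susp T Y) k"
    using suspm_surj[OF neg_Hom[OF k'] F(1) Y] by blast
  have "neg (susp T F) (susp T Y) (suspm T u) = k"
    using u(2) neg_unique[OF neg_Hom[OF k'] k'] padd_neg[OF k'] by simp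
  then have "distinguished T F Y Z u v c"
    using TR2[OF u(1) assms, of c] c t F(2) by simp
  then show thesis using that by blast
qed

section \<open>Integer shifts\<close>

lemma shift_0: "shift T 0 X = X"
  unfolding shift_def by simp

lemma shift_obj: "X \<in> obj T \<Longrightarrow> shift T n X \<in> obj T"
proof -
  assume X: "X \<in> obj T"
  have "(susp T ^^ k) X \<in> obj T" "(unsusp T ^^ k) X \<in> obj T" for k
    by (induction k) (auto simp: X susp_obj unsusp_obj)
  then show ?thesis unfolding shift_def by simp
qed

lemma shift_plus1:
  assumes "X \<in> obj T"
  shows "shift T (n + 1) X = susp T (shift T n X)"
proof (cases "0 \<le> n")
  case True
  then have "nat (n + 1) = Suc (nat n)" by simp
  then show ?thesis using True unfolding shift_def by simp
next
  case False
  define k where "k = nat (- (n + 1))"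
  have k: "nat (- n) = Suc k" using False unfolding k_def by simp
  have U: "(unsusp T ^^ k) X \<in> obj T" by (induction k) (auto simp: assms unsusp_obj)
  have "shift T n X = unsusp T ((unsusp T ^^ k) X)" using False k unfolding shift_def by simp
  then have s: "susp T (shift T n X) = (unsusp T ^^ k) X" using susp_unsusp[OF U] by simp
  \<comment> \<open>At \<open>n = - 1\<close> the two sides fall into different branches of the
    definition of \<open>shift\<close>.\<close>
  show ?thesis
  proof (cases "n = - 1")
    case True
    then show ?thesis using s k unfolding shift_def by simp
  next
    case False
    then show ?thesis using s \<open>\<not> 0 \<le> n\<close> unfolding shift_def k_def by simp
  qed
qed

lemma shift_minus1:
  assumes "X \<in> obj T"
  shows "shift T (n - 1) X = unsusp T (shift T n X)"
  using shift_plus1[OF assms, of "n - 1"] unsusp_susp[OF shift_obj[OF assms, of "n - 1"]] by simp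

lemma shift_add:
  assumes "X \<in> obj T"
  shows "shift T m (shift T n X) = shift T (m + n) X"
proof (induction m rule: int_induct[where k = 0])
  case base
  then show ?case by (simp add: shift_0)
next
  case (step1 i)
  then show ?case
    using shift_plus1[OF assms, of "i + n"] shift_plus1[OF shift_obj[OF assms], of i n]
    by (simp add: ac_simps)
next
  case (step2 i)
  have "i - 1 + n = (i + n) - 1" by simp
  then show ?case
    using step2 shift_minus1[OF assms, of "i + n"] shift_minus1[OF shift_obj[OF assms], of i n]
    by metis
qed

lemma shift_1: "shift T 1 X = susp T X"
  unfolding shift_def by simp

lemma shift_neg1: "shift T (- 1) X = unsusp T X"
  unfolding shift_def by simp

lemma hom_vanishes_shift:
  assumes "X \<in> obj T" "Y \<in> obj T"
  shows "hom_vanishes T (shift T k X) (shift T k Y) \<longleftrightarrow> hom_vanishes T X Y"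
proof (induction k rule: int_induct[where k = 0])
  case base
  then show ?case by (simp add: shift_0)
next
  case (step1 i)
  then show ?case using hom_vanishes_susp shift_obj assms by (simp add: shift_plus1)
next
  case (step2 i)
  then show ?case
    using hom_vanishes_susp[of "shift T (i - 1) X" "shift T (i - 1) Y"] shift_obj assms
      shift_plus1[of _ "i - 1"] by simp
qed

lemma hom_vanishes_shift_iff:
  assumes "X \<in> obj T" "Y \<in> obj T"
  shows "hom_vanishes T (shift T m X) (shift T n Y) \<longleftrightarrow> hom_vanishes T X (shift T (n - m) Y)"
  using hom_vanishes_shift[OF assms(1) shift_obj[OF assms(2)], of m "n - m"] shift_add[OF assms(2)]
  by simp

end


section \<open>Small sets\<close>

lemma small_image: "small U A \<Longrightarrow> small U (f ` A)"
  unfolding small_def using card_of_image ordLeq_ordLess_trans by blast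

lemma small_subset: "small U B \<Longrightarrow> A \<subseteq> B \<Longrightarrow> small U A"
  unfolding small_def using card_of_mono1 ordLeq_ordLess_trans by blast

text \<open>Regularity of the cardinal of \<open>'u\<close> enters here. It makes the set of all
  maps from members of \<open>\<G>\<close> to a fixed object small, so that it can index a
  coproduct.\<close>

lemma small_UNION:
  assumes U: "universe U" and "small U I" "\<And>i. i \<in> I \<Longrightarrow> small U (A i)"
  shows "small U (\<Union>i\<in>I. A i)"
proof -
  have "(card_of (UNIV :: nat set), card_of (UNIV :: 'a set)) \<in> ordLess"
    using U unfolding universe_def small_def by simp
  then have "infinite (UNIV :: 'a set)"
    using card_of_ordLeq_infinite infinite_UNIV_nat ordLess_imp_ordLeq by blast
  then have "Cinfinite (card_of (UNIV :: 'a set))"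
    using card_of_Card_order by (auto simp: cinfinite_def Field_card_of)
  then show ?thesis
    using card_of_UNION_ordLess_infinite_Field_regularCard[of "card_of (UNIV :: 'a set)" I A] assms
    unfolding universe_def small_def by blast
qed

lemma small_embedding:
  assumes "small (U :: 'u itself) A"
  obtains e :: "'a \<Rightarrow> 'u" where "inj_on e A" "small U (e ` A)"
proof -
  have "(card_of A, card_of (UNIV :: 'u set)) \<in> ordLeq"
    using assms ordLess_imp_ordLeq unfolding small_def by blast
  then obtain e :: "'a \<Rightarrow> 'u" where "inj_on e A" unfolding card_of_ordLeq[symmetric] by blast
  then show thesis using that small_image[OF assms] by blast
qed


section \<open>Coproducts and compact objects\<close>

lemma is_coproductD:
  assumes "is_coproduct T I X P \<iota>"
  shows "P \<in> obj T" "\<And>i. i \<in> I \<Longrightarrow> \<iota> i \<in> Hom T (X i) P"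
  using assms unfolding is_coproduct_def by auto

lemma coproduct_ex1:
  assumes "is_coproduct T I X P \<iota>" "Z \<in> obj T" "\<forall>i \<in> I. f i \<in> Hom T (X i) Z"
  shows "\<exists>!h. h \<in> Hom T P Z \<and> (\<forall>i \<in> I. cmp T h (\<iota> i) = f i)"
  using assms unfolding is_coproduct_def by blast

lemma coproduct_map:
  assumes "is_coproduct T I X P \<iota>" "Z \<in> obj T" "\<And>i. i \<in> I \<Longrightarrow> f i \<in> Hom T (X i) Z"
  obtains h where "h \<in> Hom T P Z" "\<And>i. i \<in> I \<Longrightarrow> cmp T h (\<iota> i) = f i"
proof -
  have "\<forall>i \<in> I. f i \<in> Hom T (X i) Z" using assms(3) by blast
  then show thesis using ex1_implies_ex[OF coproduct_ex1[OF assms(1,2)]] that by blast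
qed

text \<open>Coproducts and compactness are given for index sets inside \<open>'u\<close>, while the
  construction uses coproducts indexed by natural numbers and by sets of morphisms. An injection
  into \<open>'u\<close> transports one to the other.\<close>

lemma is_coproduct_reindex:
  assumes "inj_on e J"
  shows "is_coproduct T (e ` J) X P \<iota> \<longleftrightarrow> is_coproduct T J (X \<circ> e) P (\<iota> \<circ> e)"
proof -
  have eq: "(\<forall>f. (\<forall>i \<in> e ` J. f i \<in> Hom T (X i) Z) \<longrightarrow>
         (\<exists>!h. h \<in> Hom T P Z \<and> (\<forall>i \<in> e ` J. cmp T h (\<iota> i) = f i)))
      \<longleftrightarrow> (\<forall>f. (\<forall>j \<in> J. f j \<in> Hom T (X (e j)) Z) \<longrightarrow>
         (\<exists>!h. h \<in> Hom T P Z \<and> (\<forall>j \<in> J. cmp T h (\<iota> (e j)) = f j)))" (is "?l \<longleftrightarrow> ?r") for Z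
  proof
    assume l: ?l
    show ?r
    proof (intro allI impI)
      fix f assume f: "\<forall>j \<in> J. f j \<in> Hom T (X (e j)) Z"
      have i: "inv_into J e (e j) = j" if "j \<in> J" for j using assms that by simp
      have "\<forall>i \<in> e ` J. f (inv_into J e i) \<in> Hom T (X i) Z" using f i by auto
      then have "\<exists>!h. h \<in> Hom T P Z \<and> (\<forall>i \<in> e ` J. cmp T h (\<iota> i) = f (inv_into J e i))"
        using l[THEN spec, of "\<lambda>i. f (inv_into J e i)"] by simp
      then show "\<exists>!h. h \<in> Hom T P Z \<and> (\<forall>j \<in> J. cmp T h (\<iota> (e j)) = f j)"
        using i by (simp add: ball_simps)
    qed
  next
    assume r: ?r
    show ?l
    proof (intro allI impI)
      fix f assume f: "\<forall>i \<in> e ` J. f i \<in> Hom T (X i) Z"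
      then have "\<exists>!h. h \<in> Hom T P Z \<and> (\<forall>j \<in> J. cmp T h (\<iota> (e j)) = f (e j))"
        using r[THEN spec, of "\<lambda>j. f (e j)"] by simp
      then show "\<exists>!h. h \<in> Hom T P Z \<and> (\<forall>i \<in> e ` J. cmp T h (\<iota> i) = f i)"
        by (simp add: ball_simps)
    qed
  qed
  show ?thesis unfolding is_coproduct_def eq by simp
qed

lemma small_coproduct:
  fixes U :: "'u itself"
  assumes "has_small_coproducts U T" "small U J" "X ` (J :: 'j set) \<subseteq> obj T"
  obtains P \<iota> where "is_coproduct T J X P \<iota>"
proof -
  obtain e :: "'j \<Rightarrow> 'u" where e: "inj_on e J" "small U (e ` J)" using small_embedding[OF assms(2)] by blast
  have i: "inv_into J e (e j) = j" if "j \<in> J" for j using e that by simp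
  have "(X \<circ> inv_into J e) ` e ` J \<subseteq> obj T" using assms(3) i by auto
  then obtain P \<iota> where "is_coproduct T (e ` J) (X \<circ> inv_into J e) P \<iota>"
    using assms(1) e(2) unfolding has_small_coproducts_def by blast
  then have "is_coproduct T J (X \<circ> inv_into J e \<circ> e) P (\<iota> \<circ> e)"
    by (simp only: is_coproduct_reindex[OF e(1)])
  then have "is_coproduct T J X P (\<iota> \<circ> e)"
    unfolding is_coproduct_def using i by simp
  then show thesis using that by blast
qed

text \<open>The elements of \<open>Hom(S, P)\<close> in the image of the direct sum, in a form that
  supports induction on the number of summands. \<open>J\<close> is only a bound for the support,
  since coefficients may be zero; carrying it along makes the projections outside \<open>J\<close>
  vanish.\<close>

inductive fin_comb ::
  "('o, 'm) tri_cat \<Rightarrow> 'o \<Rightarrow> 'i set \<Rightarrow> ('i \<Rightarrow> 'o) \<Rightarrow> 'o \<Rightarrow> ('i \<Rightarrow> 'm) \<Rightarrow> 'i set \<Rightarrow> 'm \<Rightarrow> bool"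
  for T S I X P \<iota> where
  empty: "fin_comb T S I X P \<iota> {} (zarr T S P)"
| insert: "\<lbrakk>fin_comb T S I X P \<iota> J f; i \<in> I; i \<notin> J; g \<in> Hom T S (X i)\<rbrakk>
    \<Longrightarrow> fin_comb T S I X P \<iota> (insert i J) (padd T (cmp T (\<iota> i) g) f)"

text \<open>This is only the surjectivity of the comparison map; its injectivity is automatic,
  since coproducts in an additive category have projections.\<close>

definition finitary :: "'u itself \<Rightarrow> ('o, 'm) tri_cat \<Rightarrow> 'o \<Rightarrow> bool" where
  "finitary U T S \<longleftrightarrow> S \<in> obj T \<and>
     (\<forall>(I :: 'u set) X P \<iota>. small U I \<and> X ` I \<subseteq> obj T \<and> is_coproduct T I X P \<iota> \<longrightarrow>
       (\<forall>f \<in> Hom T S P. \<exists>J. fin_comb T S I X P \<iota> J f))"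

lemma fin_comb_finite: "fin_comb T S I X P \<iota> J f \<Longrightarrow> finite J"
  by (induction rule: fin_comb.induct) auto

text \<open>Besides changing the index set, this serves with \<open>e = id\<close> to exchange
  families that agree only on the index set.\<close>

lemma fin_comb_reindex:
  assumes "fin_comb T S (e ` K) X P \<iota> J f"
    and X: "\<And>k. k \<in> K \<Longrightarrow> X (e k) = X' k" and \<iota>: "\<And>k. k \<in> K \<Longrightarrow> \<iota> (e k) = \<iota>' k"
  shows "\<exists>L. J = e ` L \<and> fin_comb T S K X' P \<iota>' L f"
  using assms(1)
proof induction
  case empty
  then show ?case using fin_comb.empty[of T S K X' P \<iota>'] by auto
next
  case (insert J f i g)
  obtain k where k: "k \<in> K" "i = e k" using insert.hyps by blast
  obtain L where L: "J = e ` L" "fin_comb T S K X' P \<iota>' L f" using insert.IH by blast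
  have "k \<notin> L" using L(1) k insert.hyps by blast
  then have "fin_comb T S K X' P \<iota>' (insert k L) (padd T (cmp T (\<iota>' k) g) f)"
    using fin_comb.insert[OF L(2) k(1), of g] insert.hyps k X by simp
  then have "fin_comb T S K X' P \<iota>' (insert k L) (padd T (cmp T (\<iota> i) g) f)"
    using \<iota>[OF k(1)] k(2) by simp
  moreover have "insert i J = e ` insert k L" using L(1) k(2) by simp
  ultimately show ?case by blast
qed

lemma finitary_fin_comb:
  fixes U :: "'u itself" and J :: "'j set"
  assumes "finitary U T S" "small U J" "X ` J \<subseteq> obj T" "is_coproduct T J X P \<iota>" "f \<in> Hom T S P"
  obtains K where "fin_comb T S J X P \<iota> K f"
proof -
  obtain e :: "'j \<Rightarrow> 'u" where e: "inj_on e J" "small U (e ` J)" using small_embedding[OF assms(2)] by blast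
  have i: "inv_into J e (e j) = j" if "j \<in> J" for j using e that by simp
  let ?X = "X \<circ> inv_into J e" and ?\<iota> = "\<iota> \<circ> inv_into J e"
  have X: "?X ` e ` J \<subseteq> obj T" using assms(3) i by auto
  have "is_coproduct T J (?X \<circ> e) P (?\<iota> \<circ> e)"
    using assms(4) i unfolding is_coproduct_def by simp
  then have c: "is_coproduct T (e ` J) ?X P ?\<iota>" by (simp only: is_coproduct_reindex[OF e(1)])
  then obtain K where "fin_comb T S (e ` J) ?X P ?\<iota> K f"
    using assms(1)[unfolded finitary_def, THEN conjunct2, rule_format, OF conjI[OF e(2) conjI[OF X c]] assms(5)]
    by blast
  then show thesis using that fin_comb_reindex[of T S e J ?X P ?\<iota> K f X \<iota>] i by auto
qed

context additive_category
begin

lemma fin_comb_Hom: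
  assumes "fin_comb T S I X P \<iota> J f" "is_coproduct T I X P \<iota>" "S \<in> obj T"
  shows "f \<in> Hom T S P"
  using assms(1)
proof induction
  case empty
  show ?case by (rule zarr_Hom[OF assms(3) is_coproductD(1)[OF assms(2)]])
next
  case (insert J f i g)
  show ?case
    by (rule padd_Hom[OF cmp_Hom[OF insert.hyps(4) is_coproductD(2)[OF assms(2) insert.hyps(2)]] insert.IH])
qed

lemma coproduct_map_eq:
  assumes "is_coproduct T I X P \<iota>" "h \<in> Hom T P Z" "h' \<in> Hom T P Z"
    and "\<And>i. i \<in> I \<Longrightarrow> h \<cdot> \<iota> i = h' \<cdot> \<iota> i"
  shows "h = h'"
proof -
  have "\<forall>i \<in> I. h \<cdot> \<iota> i \<in> Hom T (X i) Z"
    using cmp_Hom[OF is_coproductD(2)[OF assms(1)] assms(2)] by blast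
  from coproduct_ex1[OF assms(1) Hom_target[OF assms(2)] this] show ?thesis
    by (rule ex1E) (metis assms(2-4))
qed

lemma coproduct_projections:
  assumes "is_coproduct T I X P \<iota>" "X ` I \<subseteq> obj T"
  obtains p where "\<And>j. j \<in> I \<Longrightarrow> p j \<in> Hom T P (X j)"
    "\<And>j. j \<in> I \<Longrightarrow> p j \<cdot> \<iota> j = ident T (X j)"
    "\<And>i j. i \<in> I \<Longrightarrow> j \<in> I \<Longrightarrow> i \<noteq> j \<Longrightarrow> p j \<cdot> \<iota> i = zarr T (X i) (X j)"
proof -
  have "\<exists>p. p \<in> Hom T P (X j) \<and>
      (\<forall>i \<in> I. p \<cdot> \<iota> i = (if i = j then ident T (X j) else zarr T (X i) (X j)))" if "j \<in> I" for j
  proof -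
    have "\<forall>i \<in> I. (if i = j then ident T (X j) else zarr T (X i) (X j)) \<in> Hom T (X i) (X j)"
      using that assms(2) ident_Hom[of "X j"] zarr_Hom[of _ "X j"] by (simp add: image_subset_iff)
    moreover have "X j \<in> obj T" using that assms(2) by blast
    ultimately show ?thesis
      using ex1_implies_ex[OF coproduct_ex1[OF assms(1),
            where f = "\<lambda>i. if i = j then ident T (X j) else zarr T (X i) (X j)"]] by simp
  qed
  then have "\<exists>p. \<forall>j \<in> I. p j \<in> Hom T P (X j) \<and>
      (\<forall>i \<in> I. p j \<cdot> \<iota> i = (if i = j then ident T (X j) else zarr T (X i) (X j)))"
    by (intro bchoice) blast
  then obtain p where p: "\<forall>j \<in> I. p j \<in> Hom T P (X j) \<and>
      (\<forall>i \<in> I. p j \<cdot> \<iota> i = (if i = j then ident T (X j) else zarr T (X i) (X j)))"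
    by blast
  show thesis by (rule that[of p]) (use p in simp_all)
qed

lemma fin_comb_projection_outside:
  assumes "fin_comb T S I X P \<iota> J f" "is_coproduct T I X P \<iota>" "S \<in> obj T"
    and "j \<in> I" "j \<notin> J" "p \<in> Hom T P (X j)"
    and p0: "\<And>i. i \<in> I \<Longrightarrow> i \<noteq> j \<Longrightarrow> p \<cdot> \<iota> i = zarr T (X i) (X j)"
  shows "p \<cdot> f = zarr T S (X j)"
  using assms(1,5)
proof induction
  case empty
  then show ?case using cmp_zarr[OF assms(6,3)] by simp
next
  case (insert J f i g)
  have f: "f \<in> Hom T S P" by (rule fin_comb_Hom[OF insert.hyps(1) assms(2,3)])
  have \<iota>: "\<iota> i \<in> Hom T (X i) P" by (rule is_coproductD(2)[OF assms(2) insert.hyps(2)])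
  have Xj: "X j \<in> obj T" by (rule Hom_target[OF assms(6)])
  have "p \<cdot> padd T (\<iota> i \<cdot> g) f = padd T (p \<cdot> (\<iota> i \<cdot> g)) (p \<cdot> f)"
    using cmp_padd_right[OF cmp_Hom[OF insert.hyps(4) \<iota>] f assms(6)] .
  also have "p \<cdot> (\<iota> i \<cdot> g) = zarr T S (X j)"
    using cmp_assoc[OF insert.hyps(4) \<iota> assms(6)] p0[of i] insert.hyps insert.prems zarr_cmp[OF insert.hyps(4) Xj] by auto
  also have "p \<cdot> f = zarr T S (X j)" using insert.IH insert.prems by blast
  finally show ?case using padd_zarr[OF zarr_Hom[OF assms(3) Xj]] by simp
qed

lemma fin_comb_zero:
  assumes "fin_comb T S I X P \<iota> J f" "is_coproduct T I X P \<iota>" "S \<in> obj T"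
    and p: "\<And>j. j \<in> I \<Longrightarrow> p j \<in> Hom T P (X j)"
    and p1: "\<And>j. j \<in> I \<Longrightarrow> p j \<cdot> \<iota> j = ident T (X j)"
    and p0: "\<And>i j. i \<in> I \<Longrightarrow> j \<in> I \<Longrightarrow> i \<noteq> j \<Longrightarrow> p j \<cdot> \<iota> i = zarr T (X i) (X j)"
    and "\<And>j. j \<in> I \<Longrightarrow> p j \<cdot> f = zarr T S (X j)"
  shows "f = zarr T S P"
  using assms(1,7)
proof induction
  case empty
  then show ?case by simp
next
  case (insert J f i g)
  note g = insert.hyps(4) and pi = p[OF insert.hyps(2)]
  have f: "f \<in> Hom T S P" by (rule fin_comb_Hom[OF insert.hyps(1) assms(2,3)])
  have \<iota>: "\<iota> i \<in> Hom T (X i) P" by (rule is_coproductD(2)[OF assms(2) insert.hyps(2)])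
  have "p i \<cdot> padd T (\<iota> i \<cdot> g) f = padd T (p i \<cdot> (\<iota> i \<cdot> g)) (p i \<cdot> f)"
    by (rule cmp_padd_right[OF cmp_Hom[OF g \<iota>] f pi])
  also have "p i \<cdot> (\<iota> i \<cdot> g) = g"
    using cmp_assoc[OF g \<iota> pi] p1[OF insert.hyps(2)] ident_cmp[OF g] by simp
  also have "p i \<cdot> f = zarr T S (X i)"
    using fin_comb_projection_outside[OF insert.hyps(1) assms(2,3) insert.hyps(2,3) pi] p0 insert.hyps by blast
  finally have "g = zarr T S (X i)" using padd_zarr[OF g] insert.prems[OF insert.hyps(2)] by simp
  then have eq: "padd T (\<iota> i \<cdot> g) f = f" using cmp_zarr[OF \<iota> assms(3)] padd_zarr[OF f] by simp
  then have "\<And>j. j \<in> I \<Longrightarrow> p j \<cdot> f = zarr T S (X j)" using insert.prems by simp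
  then show ?case using insert.IH eq by simp
qed

lemma fin_comb_vanishing:
  assumes "fin_comb T S I X P \<iota> J f" "is_coproduct T I X P \<iota>" "S \<in> obj T"
    and "\<And>i. i \<in> I \<Longrightarrow> hom_vanishes T S (X i)"
  shows "f = zarr T S P"
  using assms(1)
proof induction
  case empty
  then show ?case by simp
next
  case (insert J f i g)
  have \<iota>: "\<iota> i \<in> Hom T (X i) P" by (rule is_coproductD(2)[OF assms(2) insert.hyps(2)])
  have "g = zarr T S (X i)" by (rule hom_vanishesD[OF assms(4)[OF insert.hyps(2)] insert.hyps(4)])
  then show ?case
    using insert.IH cmp_zarr[OF \<iota> assms(3)] padd_zarr[OF zarr_Hom[OF assms(3) Hom_target[OF \<iota>]]] by simp
qed

lemma fin_comb_finprod:
  assumes "is_coproduct T I X P \<iota>" "S \<in> obj T"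
    and "finite J" "J \<subseteq> I" "\<And>i. i \<in> J \<Longrightarrow> f i \<in> Hom T S (X i)"
  shows "fin_comb T S I X P \<iota> J (finprod (hom_group T S P) (\<lambda>i. \<iota> i \<cdot> f i) J)"
proof -
  interpret comm_group "hom_group T S P"
    using assms is_coproductD by (intro hom_comm_group) auto
  show ?thesis using assms(3,4,5)
  proof (induction J rule: finite_induct)
    case empty
    then show ?case using fin_comb.empty by fastforce
  next
    case (insert i J)
    have c: "\<iota> j \<cdot> f j \<in> Hom T S P" if "j \<in> insert i J" for j
      using cmp_Hom[OF insert.prems(2)[OF that] is_coproductD(2)[OF assms(1)]] insert.prems(1) that
      by blast
    have "finprod (hom_group T S P) (\<lambda>i. \<iota> i \<cdot> f i) (insert i J)
        = padd T (\<iota> i \<cdot> f i) (finprod (hom_group T S P) (\<lambda>i. \<iota> i \<cdot> f i) J)"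
      using finprod_insert[of J i "\<lambda>i. \<iota> i \<cdot> f i"] insert.hyps c by auto
    then show ?case
      using fin_comb.insert[of T S I X P \<iota> J _ i "f i"] insert.IH insert.hyps insert.prems by simp
  qed
qed

lemma compact_finitary:
  assumes "compact_object U T S"
  shows "finitary U T S"
  unfolding finitary_def
proof (intro conjI allI impI ballI)
  show S: "S \<in> obj T" using assms unfolding compact_object_def by simp
  fix I :: "'c set" and X P \<iota> f
  assume *: "small U I \<and> X ` I \<subseteq> obj T \<and> is_coproduct T I X P \<iota>" and f: "f \<in> Hom T S P"
  then have "coproduct_comparison T S I X P \<iota>
      \<in> iso (sum_group I (\<lambda>i. hom_group T S (X i))) (hom_group T S P)"
    using assms unfolding compact_object_def by blast
  then have "f \<in> coproduct_comparison T S I X P \<iota> ` carrier (sum_group I (\<lambda>i. hom_group T S (X i)))"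
    using f unfolding iso_def bij_betw_def by simp
  moreover have "group (hom_group T S (X i))" if "i \<in> I" for i
    using that * S hom_comm_group comm_group.axioms(2) by blast
  ultimately obtain x where x: "x \<in> (\<Pi>\<^sub>E i\<in>I. Hom T S (X i))" "finite {i \<in> I. x i \<noteq> zarr T S (X i)}"
    and fx: "f = coproduct_comparison T S I X P \<iota> x"
    using carrier_sum_group[of I "\<lambda>i. hom_group T S (X i)"] by auto
  have "fin_comb T S I X P \<iota> {i \<in> I. x i \<noteq> zarr T S (X i)} f"
    unfolding fx coproduct_comparison_def using * S x by (intro fin_comb_finprod) auto
  then show "\<exists>J. fin_comb T S I X P \<iota> J f" by blast
qed

end

context triangulated_category
begin

section \<open>Coproducts, finite combinations and compactness under suspension\<close>

lemma is_coproduct_susp_iff: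
  assumes P: "P \<in> obj T" and \<iota>: "\<And>i. i \<in> I \<Longrightarrow> \<iota> i \<in> Hom T (X i) P"
  shows "is_coproduct T I (\<lambda>i. susp T (X i)) (susp T P) (\<lambda>i. suspm T (\<iota> i))
    \<longleftrightarrow> is_coproduct T I X P \<iota>"
proof
  assume c: "is_coproduct T I (\<lambda>i. susp T (X i)) (susp T P) (\<lambda>i. suspm T (\<iota> i))"
  show "is_coproduct T I X P \<iota>"
    unfolding is_coproduct_def
  proof (intro conjI ballI allI impI)
    fix Z f assume Z: "Z \<in> obj T" and f: "\<forall>i \<in> I. f i \<in> Hom T (X i) Z"
    have "\<forall>i \<in> I. suspm T (f i) \<in> Hom T (susp T (X i)) (susp T Z)" using f suspm_Hom by blast
    then obtain k where k: "k \<in> Hom T (susp T P) (susp T Z)"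
        "\<And>i. i \<in> I \<Longrightarrow> k \<cdot> suspm T (\<iota> i) = suspm T (f i)"
      using coproduct_map[OF c susp_obj[OF Z], of "\<lambda>i. suspm T (f i)"] by blast
    obtain h where h: "h \<in> Hom T P Z" "suspm T h = k" using suspm_surj[OF k(1) P Z] by blast
    have hf: "h \<cdot> \<iota> i = f i" if "i \<in> I" for i
      using suspm_inj[OF cmp_Hom[OF \<iota>[OF that] h(1)] f[rule_format, OF that]]
        suspm_cmp[OF \<iota>[OF that] h(1)] h(2) k(2)[OF that] by simp
    show "\<exists>!h. h \<in> Hom T P Z \<and> (\<forall>i \<in> I. h \<cdot> \<iota> i = f i)"
    proof (rule ex1I[of _ h])
      show "h \<in> Hom T P Z \<and> (\<forall>i \<in> I. h \<cdot> \<iota> i = f i)" using h(1) hf by blast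
      fix h' assume h': "h' \<in> Hom T P Z \<and> (\<forall>i \<in> I. h' \<cdot> \<iota> i = f i)"
      have "suspm T h' = suspm T h"
      proof (rule coproduct_map_eq[OF c])
        show "suspm T h' \<in> Hom T (susp T P) (susp T Z)" "suspm T h \<in> Hom T (susp T P) (susp T Z)"
          using suspm_Hom h' h(1) by blast+
        show "suspm T h' \<cdot> suspm T (\<iota> i) = suspm T h \<cdot> suspm T (\<iota> i)" if "i \<in> I" for i
          using suspm_cmp[OF \<iota>[OF that]] h' h(1) hf that by metis
      qed
      then show "h' = h" using suspm_inj h' h(1) by blast
    qed
  qed (use P \<iota> in auto)
next
  assume c: "is_coproduct T I X P \<iota>"
  show "is_coproduct T I (\<lambda>i. susp T (X i)) (susp T P) (\<lambda>i. suspm T (\<iota> i))"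
    unfolding is_coproduct_def
  proof (intro conjI ballI allI impI)
    fix Z' f' assume Z': "Z' \<in> obj T" and f': "\<forall>i \<in> I. f' i \<in> Hom T (susp T (X i)) Z'"
    define Z where "Z = unsusp T Z'"
    have Z: "Z \<in> obj T" "Z' = susp T Z" unfolding Z_def using Z' unsusp_obj susp_unsusp by auto
    have "\<exists>f. f \<in> Hom T (X i) Z \<and> suspm T f = f' i" if "i \<in> I" for i
      using suspm_surj[of "f' i" "X i" Z] f' Z Hom_source[OF \<iota>[OF that]] that by blast
    then have "\<exists>f. \<forall>i \<in> I. f i \<in> Hom T (X i) Z \<and> suspm T (f i) = f' i" by (intro bchoice) blast
    then obtain f where f: "\<forall>i \<in> I. f i \<in> Hom T (X i) Z \<and> suspm T (f i) = f' i" by blast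
    obtain h where h: "h \<in> Hom T P Z" "\<And>i. i \<in> I \<Longrightarrow> h \<cdot> \<iota> i = f i"
      using coproduct_map[OF c Z(1), of f] f by blast
    show "\<exists>!h. h \<in> Hom T (susp T P) Z' \<and> (\<forall>i \<in> I. h \<cdot> suspm T (\<iota> i) = f' i)"
    proof (rule ex1I[of _ "suspm T h"])
      show "suspm T h \<in> Hom T (susp T P) Z' \<and> (\<forall>i \<in> I. suspm T h \<cdot> suspm T (\<iota> i) = f' i)"
        using suspm_Hom[OF h(1)] Z(2) suspm_cmp[OF \<iota> h(1)] h(2) f by metis
      fix k assume k: "k \<in> Hom T (susp T P) Z' \<and> (\<forall>i \<in> I. k \<cdot> suspm T (\<iota> i) = f' i)"
      obtain h' where h': "h' \<in> Hom T P Z" "suspm T h' = k"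
        using suspm_surj[of k P Z] k Z P by blast
      have "h' = h"
      proof (rule coproduct_map_eq[OF c h'(1) h(1)])
        fix i assume i: "i \<in> I"
        have "suspm T (h' \<cdot> \<iota> i) = suspm T (f i)"
          using suspm_cmp[OF \<iota>[OF i] h'(1)] h'(2) k f i by simp
        then show "h' \<cdot> \<iota> i = h \<cdot> \<iota> i"
          using suspm_inj[OF cmp_Hom[OF \<iota>[OF i] h'(1)]] f h(2) i by metis
      qed
      then show "k = suspm T h" using h'(2) by simp
    qed
  qed (use P \<iota> susp_obj suspm_Hom in auto)
qed

lemma fin_comb_susp:
  assumes "fin_comb T S I X P \<iota> J f" and c: "is_coproduct T I X P \<iota>" and S: "S \<in> obj T"
  shows "fin_comb T (susp T S) I (\<lambda>i. susp T (X i)) (susp T P) (\<lambda>i. suspm T (\<iota> i)) J (suspm T f)"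
  using assms(1)
proof induction
  case empty
  show ?case unfolding suspm_zarr[OF S is_coproductD(1)[OF c]] by (rule fin_comb.empty)
next
  case (insert J f i g)
  note \<iota> = is_coproductD(2)[OF c insert.hyps(2)] and g = insert.hyps(4)
  have "suspm T (padd T (\<iota> i \<cdot> g) f) = padd T (suspm T (\<iota> i) \<cdot> suspm T g) (suspm T f)"
    using suspm_padd[OF cmp_Hom[OF g \<iota>] fin_comb_Hom[OF insert.hyps(1) c S]] suspm_cmp[OF g \<iota>]
    by simp
  then show ?case
    using fin_comb.insert[OF insert.IH insert.hyps(2,3) suspm_Hom[OF g]] by simp
qed

lemma fin_comb_unsusp:
  assumes "fin_comb T (susp T S) I (\<lambda>i. susp T (X i)) (susp T P) (\<lambda>i. suspm T (\<iota> i)) J k"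
    and c: "is_coproduct T I X P \<iota>" and S: "S \<in> obj T"
  shows "\<exists>f. suspm T f = k \<and> fin_comb T S I X P \<iota> J f"
  using assms(1)
proof induction
  case empty
  show ?case
    using suspm_zarr[OF S is_coproductD(1)[OF c]] fin_comb.empty[of T S I X P \<iota>] by blast
next
  case (insert J k i g')
  note \<iota> = is_coproductD(2)[OF c insert.hyps(2)]
  obtain g where g: "g \<in> Hom T S (X i)" "suspm T g = g'"
    using suspm_surj[OF insert.hyps(4) S Hom_source[OF \<iota>]] by blast
  obtain f where f: "suspm T f = k" "fin_comb T S I X P \<iota> J f" using insert.IH by blast
  have "suspm T (padd T (\<iota> i \<cdot> g) f) = padd T (suspm T (\<iota> i) \<cdot> g') k"
    using suspm_padd[OF cmp_Hom[OF g(1) \<iota>] fin_comb_Hom[OF f(2) c S]] suspm_cmp[OF g(1) \<iota>]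
      f(1) g(2) by simp
  then show ?case using fin_comb.insert[OF f(2) insert.hyps(2,3) g(1)] by blast
qed

text \<open>The suspension is bijective on objects and morphisms, so every coproduct is strictly the
  suspension of a coproduct, and there the finiteness for \<open>S\<close> applies.\<close>

lemma finitary_susp:
  assumes "finitary U T S"
  shows "finitary U T (susp T S)"
  unfolding finitary_def
proof (intro conjI allI impI ballI)
  have S: "S \<in> obj T" using assms unfolding finitary_def by simp
  then show "susp T S \<in> obj T" by (rule susp_obj)
  fix I :: "'c set" and X' P' \<iota>' f'
  assume *: "small U I \<and> X' ` I \<subseteq> obj T \<and> is_coproduct T I X' P' \<iota>'"
    and f': "f' \<in> Hom T (susp T S) P'"
  define X P where "X = (\<lambda>i. unsusp T (X' i))" and "P = unsusp T P'"
  have P: "P \<in> obj T" "susp T P = P'"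
    unfolding P_def using Hom_target[OF f'] unsusp_obj susp_unsusp by auto
  have X: "X i \<in> obj T" "susp T (X i) = X' i" if "i \<in> I" for i
    unfolding X_def using * that unsusp_obj susp_unsusp by auto
  have "\<exists>a. a \<in> Hom T (X i) P \<and> suspm T a = \<iota>' i" if "i \<in> I" for i
    using suspm_surj[of "\<iota>' i" "X i" P] is_coproductD(2)[of T I X' P' \<iota>' i] * X[OF that] P that
    by metis
  then have "\<exists>\<iota>. \<forall>i \<in> I. \<iota> i \<in> Hom T (X i) P \<and> suspm T (\<iota> i) = \<iota>' i" by (intro bchoice) blast
  then obtain \<iota> where \<iota>: "\<And>i. i \<in> I \<Longrightarrow> \<iota> i \<in> Hom T (X i) P" "\<And>i. i \<in> I \<Longrightarrow> suspm T (\<iota> i) = \<iota>' i"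
    by blast
  have "is_coproduct T I (\<lambda>i. susp T (X i)) (susp T P) (\<lambda>i. suspm T (\<iota> i))"
    using * X(2) \<iota>(2) P(2) unfolding is_coproduct_def by simp
  moreover have "is_coproduct T I (\<lambda>i. susp T (X i)) (susp T P) (\<lambda>i. suspm T (\<iota> i))
      \<longleftrightarrow> is_coproduct T I X P \<iota>"
    by (rule is_coproduct_susp_iff) (use P \<iota> in simp_all)
  ultimately have c: "is_coproduct T I X P \<iota>" by simp
  obtain f where f: "f \<in> Hom T S P" "suspm T f = f'"
    using suspm_surj[of f' S P] f' P S by blast
  have "X ` I \<subseteq> obj T" using X by blast
  then obtain J where "fin_comb T S I X P \<iota> J f"
    using finitary_fin_comb[OF assms conjunct1[OF *] _ c f(1)] by blast
  then have "fin_comb T (susp T S) (id ` I) (\<lambda>i. susp T (X i)) P' (\<lambda>i. suspm T (\<iota> i)) J f'"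
    using fin_comb_susp[OF _ c S, of J f] f(2) P(2) by simp
  from fin_comb_reindex[OF this, of X' \<iota>'] show "\<exists>J. fin_comb T (susp T S) I X' P' \<iota>' J f'"
    using X(2) \<iota>(2) by auto
qed

lemma finitary_unsusp:
  assumes "finitary U T S"
  shows "finitary U T (unsusp T S)"
  unfolding finitary_def
proof (intro conjI allI impI ballI)
  have S: "S \<in> obj T" using assms unfolding finitary_def by simp
  show S': "unsusp T S \<in> obj T" using S by (rule unsusp_obj)
  fix I :: "'c set" and X P \<iota> f
  assume *: "small U I \<and> X ` I \<subseteq> obj T \<and> is_coproduct T I X P \<iota>"
    and f: "f \<in> Hom T (unsusp T S) P"
  then have c: "is_coproduct T I X P \<iota>" by simp
  have c': "is_coproduct T I (\<lambda>i. susp T (X i)) (susp T P) (\<lambda>i. suspm T (\<iota> i))"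
    by (rule iffD2[OF is_coproduct_susp_iff[OF is_coproductD[OF c]] c])
  have X: "(\<lambda>i. susp T (X i)) ` I \<subseteq> obj T" using * susp_obj by blast
  have f': "suspm T f \<in> Hom T S (susp T P)" using suspm_Hom[OF f] susp_unsusp[OF S] by simp
  obtain J where "fin_comb T S I (\<lambda>i. susp T (X i)) (susp T P) (\<lambda>i. suspm T (\<iota> i)) J (suspm T f)"
    using finitary_fin_comb[OF assms conjunct1[OF *] X c' f'] by blast
  then obtain k where k: "suspm T k = suspm T f" "fin_comb T (unsusp T S) I X P \<iota> J k"
    using fin_comb_unsusp[OF _ c S', of J "suspm T f"] susp_unsusp[OF S] by auto
  have "k = f" using suspm_inj[OF fin_comb_Hom[OF k(2) c S'] f] k(1) by simp
  then show "\<exists>J. fin_comb T (unsusp T S) I X P \<iota> J f" using k(2) by blast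
qed

lemma finitary_shift:
  assumes "finitary U T S"
  shows "finitary U T (shift T n S)"
proof -
  have "finitary U T ((susp T ^^ k) S)" "finitary U T ((unsusp T ^^ k) S)" for k
    by (induction k) (auto simp: assms finitary_susp finitary_unsusp)
  then show ?thesis unfolding shift_def by simp
qed

end


section \<open>Homotopy colimits\<close>

text \<open>The relation between \<open>d\<close> and \<open>s\<close> says \<open>d = 1 - s\<close>.\<close>

locale homotopy_colimit = triangulated_category +
  fixes B :: "nat \<Rightarrow> 'a" and \<phi> :: "nat \<Rightarrow> 'b" and P :: 'a and \<iota> :: "nat \<Rightarrow> 'b"
    and s d :: 'b and Q :: 'a and q r :: 'b
  assumes \<phi>: "\<phi> k \<in> Hom T (B k) (B (Suc k))"
    and coproduct: "is_coproduct T UNIV B P \<iota>"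
    and s: "s \<in> Hom T P P" and s_\<iota>: "s \<cdot> \<iota> k = \<iota> (Suc k) \<cdot> \<phi> k"
    and d: "d \<in> Hom T P P" and d_s: "padd T d s = ident T P"
    and triangle: "distinguished T P P Q d q r"
begin

lemma B_obj: "B k \<in> obj T"
  using Hom_source[OF \<phi>] .

lemma P_obj: "P \<in> obj T"
  using is_coproductD(1)[OF coproduct] .

lemma \<iota>: "\<iota> k \<in> Hom T (B k) P"
  using is_coproductD(2)[OF coproduct] by simp

lemma q: "q \<in> Hom T P Q" and r: "r \<in> Hom T Q (susp T P)"
  using distinguishedD[OF triangle] by auto

text \<open>The structure map from a stage to the homotopy colimit.\<close>

definition \<gamma> :: "nat \<Rightarrow> 'b" where
  "\<gamma> k = q \<cdot> \<iota> k"

lemma \<gamma>: "\<gamma> k \<in> Hom T (B k) Q"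
  unfolding \<gamma>_def by (rule cmp_Hom[OF \<iota> q])

text \<open>The identity \<open>h \<cdot> d = h - h \<cdot> s\<close> is kept in the form of a sum,
  which spares all bookkeeping of signs.\<close>

lemma cmp_d_add:
  assumes "h \<in> Hom T P C"
  shows "padd T (h \<cdot> d) (h \<cdot> s) = h"
  using cmp_padd_right[OF d s assms] d_s cmp_ident[OF assms] by simp

lemma d_cmp_add:
  assumes "h \<in> Hom T C P"
  shows "padd T (d \<cdot> h) (s \<cdot> h) = h"
  using cmp_padd_left[OF assms d s] d_s ident_cmp[OF assms] by simp

lemma cmp_d_\<iota>:
  assumes "h \<in> Hom T P C"
  shows "padd T (h \<cdot> d \<cdot> \<iota> k) (h \<cdot> \<iota> (Suc k) \<cdot> \<phi> k) = h \<cdot> \<iota> k"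
proof -
  have "padd T (h \<cdot> d) (h \<cdot> s) \<cdot> \<iota> k = padd T ((h \<cdot> d) \<cdot> \<iota> k) ((h \<cdot> s) \<cdot> \<iota> k)"
    by (rule cmp_padd_left[OF \<iota> cmp_Hom[OF d assms] cmp_Hom[OF s assms]])
  then show ?thesis
    using cmp_d_add[OF assms] cmp_assoc[OF \<iota> d assms] cmp_assoc[OF \<iota> s assms] s_\<iota> by simp
qed

lemma \<gamma>_\<phi>: "\<gamma> (Suc k) \<cdot> \<phi> k = \<gamma> k"
proof -
  have "q \<cdot> d \<cdot> \<iota> k = zarr T (B k) Q"
    using cmp_assoc[OF \<iota> d q] triangle_comp_zero[OF triangle] zarr_cmp[OF \<iota> Hom_target[OF q]] by simp
  then have "q \<cdot> \<iota> (Suc k) \<cdot> \<phi> k = q \<cdot> \<iota> k"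
    using cmp_d_\<iota>[OF q, of k] padd_zarr(2)[OF cmp_Hom[OF cmp_Hom[OF \<phi> \<iota>] q]] by simp
  then show ?thesis unfolding \<gamma>_def using cmp_assoc[OF \<phi> \<iota> q] by simp
qed

lemma sequence_map:
  assumes "C \<in> obj T" "\<And>k. h k \<in> Hom T (B k) C"
  obtains g where "g \<in> Hom T P C" "\<And>k. g \<cdot> \<iota> k = h k"
proof -
  have "\<forall>k \<in> UNIV. h k \<in> Hom T (B k) C" using assms(2) by simp
  from ex1_implies_ex[OF coproduct_ex1[OF coproduct assms(1) this]] show thesis
    using that by auto
qed

text \<open>A cocone amounts to a map \<open>g\<close> on the coproduct with
  \<open>g \<cdot> s = g\<close>, hence to one killed by \<open>d\<close>, and such a map factors
  through \<open>q\<close>. Maps vanishing on all stages measure the ambiguity of the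
  factorization.\<close>

lemma weak_colimit:
  assumes C: "C \<in> obj T" and h: "\<And>k. h k \<in> Hom T (B k) C" and hh: "\<And>k. h (Suc k) \<cdot> \<phi> k = h k"
  obtains l where "l \<in> Hom T Q C" "\<And>k. l \<cdot> \<gamma> k = h k"
proof -
  obtain g where g: "g \<in> Hom T P C" and g\<iota>: "\<And>k. g \<cdot> \<iota> k = h k"
    using sequence_map[OF C h] by blast
  have "g \<cdot> s = g"
  proof (rule coproduct_map_eq[OF coproduct cmp_Hom[OF s g] g])
    fix k
    show "(g \<cdot> s) \<cdot> \<iota> k = g \<cdot> \<iota> k"
      using cmp_assoc[OF \<iota> s g] s_\<iota> cmp_assoc[OF \<phi> \<iota> g] g\<iota> hh by simp
  qed
  then have "g \<cdot> d = zarr T P C"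
    using cmp_d_add[OF g] padd_cancel_right[OF cmp_Hom[OF d g] zarr_Hom[OF P_obj C] g] padd_zarr[OF g]
    by simp
  then obtain l where l: "l \<in> Hom T Q C" "l \<cdot> q = g"
    using weak_cokernel[OF triangle g] by blast
  then have "l \<cdot> \<gamma> k = h k" for k
    unfolding \<gamma>_def using cmp_assoc[OF \<iota> q l(1)] g\<iota> by simp
  then show thesis using that l by blast
qed

text \<open>With \<open>a = 0\<close> this prolongs a map on \<open>B 0\<close> through the whole
  tower. With general \<open>a\<close> it solves the equation that exhibits a map on the coproduct
  as one of the form \<open>y \<cdot> d\<close>.\<close>

lemma extend_sequence:
  assumes ext: "\<And>k a. a \<in> Hom T (B k) C \<Longrightarrow> \<exists>b \<in> Hom T (B (Suc k)) C. b \<cdot> \<phi> k = a"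
    and x: "x \<in> Hom T (B 0) C" and a: "\<And>k. a k \<in> Hom T (B k) C"
  obtains h where "\<And>k. h k \<in> Hom T (B k) C" "h 0 = x" "\<And>k. h (Suc k) \<cdot> \<phi> k = padd T (h k) (a k)"
proof -
  have "\<exists>h. \<forall>k. (h k \<in> Hom T (B k) C \<and> (k = 0 \<longrightarrow> h k = x)) \<and> h (Suc k) \<cdot> \<phi> k = padd T (h k) (a k)"
  proof (rule dependent_nat_choice)
    show "\<exists>h. h \<in> Hom T (B 0) C \<and> (0 = 0 \<longrightarrow> h = x)" using x by blast
    show "\<exists>h'. (h' \<in> Hom T (B (Suc k)) C \<and> (Suc k = 0 \<longrightarrow> h' = x)) \<and> h' \<cdot> \<phi> k = padd T h (a k)"
      if "h \<in> Hom T (B k) C \<and> (k = 0 \<longrightarrow> h = x)" for h k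
      using ext[OF padd_Hom[OF _ a]] that by auto
  qed
  then show thesis using that by blast
qed

text \<open>The surjectivity assumption makes the \<open>lim\<^sup>1\<close> term of the Milnor sequence vanish.\<close>

lemma no_phantoms:
  assumes ext: "\<And>k a. a \<in> Hom T (B k) C \<Longrightarrow> \<exists>b \<in> Hom T (B (Suc k)) C. b \<cdot> \<phi> k = a"
    and C: "C \<in> obj T"
    and h: "h \<in> Hom T Q (susp T C)" and h0: "\<And>k. h \<cdot> \<gamma> k = zarr T (B k) (susp T C)"
  shows "h = zarr T Q (susp T C)"
proof -
  note SC = susp_obj[OF C]
  have "h \<cdot> q = zarr T P (susp T C)"
  proof (rule coproduct_map_eq[OF coproduct cmp_Hom[OF q h] zarr_Hom[OF P_obj SC]])
    fix k
    show "(h \<cdot> q) \<cdot> \<iota> k = zarr T P (susp T C) \<cdot> \<iota> k"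
      using h0[of k] cmp_assoc[OF \<iota> q h] zarr_cmp[OF \<iota> SC] unfolding \<gamma>_def by simp
  qed
  \<comment> \<open>The map \<open>h\<close> is determined by some \<open>g\<close> from
    \<open>P\<close> to \<open>C\<close>, and is zero as soon as \<open>g\<close> has the form
    \<open>y \<cdot> d\<close>. The rest of the proof finds \<open>y\<close>.\<close>
  then obtain g' where g': "g' \<in> Hom T (susp T P) (susp T C)" "g' \<cdot> r = h"
    using weak_cokernel[OF rotate[OF triangle] h] by blast
  obtain g where g: "g \<in> Hom T P C" "suspm T g = g'" using suspm_surj[OF g'(1) P_obj C] by blast
  \<comment> \<open>The sign is the one for which \<open>x k - x (Suc k) \<cdot> \<phi> k\<close>
    becomes \<open>g \<cdot> \<iota> k\<close>, that is, \<open>y \<cdot> d\<close> agrees with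
    \<open>g\<close> on every stage.\<close>
  have a: "neg (B k) C (g \<cdot> \<iota> k) \<in> Hom T (B k) C" for k using neg_Hom[OF cmp_Hom[OF \<iota> g(1)]] .
  obtain x where x: "\<And>k. x k \<in> Hom T (B k) C"
    "\<And>k. x (Suc k) \<cdot> \<phi> k = padd T (x k) (neg (B k) C (g \<cdot> \<iota> k))"
    using extend_sequence[OF ext zarr_Hom[OF B_obj C] a] by blast
  obtain y where y: "y \<in> Hom T P C" "\<And>k. y \<cdot> \<iota> k = x k"
    using sequence_map[OF C x(1)] by blast
  have "y \<cdot> d = g"
  proof (rule coproduct_map_eq[OF coproduct cmp_Hom[OF d y(1)] g(1)])
    fix k
    have gk: "g \<cdot> \<iota> k \<in> Hom T (B k) C" by (rule cmp_Hom[OF \<iota> g(1)])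
    have "y \<cdot> \<iota> (Suc k) \<cdot> \<phi> k = x (Suc k) \<cdot> \<phi> k"
      using cmp_assoc[OF \<phi> \<iota> y(1)] y(2) by simp
    then have e: "y \<cdot> \<iota> (Suc k) \<cdot> \<phi> k = padd T (x k) (neg (B k) C (g \<cdot> \<iota> k))"
      using x(2) by simp
    have "padd T (x k) (neg (B k) C (g \<cdot> \<iota> k)) \<in> Hom T (B k) C" by (rule padd_Hom[OF x(1) a])
    moreover have "padd T (y \<cdot> d \<cdot> \<iota> k) (padd T (x k) (neg (B k) C (g \<cdot> \<iota> k))) = x k"
      using cmp_d_\<iota>[OF y(1), of k] e y(2) by simp
    moreover have "padd T (g \<cdot> \<iota> k) (padd T (x k) (neg (B k) C (g \<cdot> \<iota> k))) = x k"
    proof -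
      interpret G: comm_group "hom_group T (B k) C" by (rule hom_comm_group[OF B_obj C])
      show ?thesis
        using G.m_lcomm[of "g \<cdot> \<iota> k" "x k" "neg (B k) C (g \<cdot> \<iota> k)"] gk x(1) a padd_neg(1)[OF gk]
          padd_zarr(1)[OF x(1)[of k]] by simp
    qed
    moreover have "y \<cdot> d \<cdot> \<iota> k \<in> Hom T (B k) C" by (rule cmp_Hom[OF cmp_Hom[OF \<iota> d] y(1)])
    ultimately have "y \<cdot> d \<cdot> \<iota> k = g \<cdot> \<iota> k" using padd_cancel_right[OF _ gk] by metis
    then show "(y \<cdot> d) \<cdot> \<iota> k = g \<cdot> \<iota> k" using cmp_assoc[OF \<iota> d y(1)] by simp
  qed
  then have "h = (suspm T y \<cdot> suspm T d) \<cdot> r" using g' g(2) suspm_cmp[OF d y(1)] by simp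
  also have "\<dots> = suspm T y \<cdot> (suspm T d \<cdot> r)"
    by (rule cmp_assoc[OF r suspm_Hom[OF d] suspm_Hom[OF y(1)]])
  also have "\<dots> = zarr T Q (susp T C)"
    using triangle_comp_zero'[OF triangle] cmp_zarr[OF suspm_Hom[OF y(1)] Hom_source[OF r]] by simp
  finally show ?thesis .
qed

text \<open>The endomorphism \<open>s\<close> moves the component at \<open>j\<close> to position
  \<open>Suc j\<close> along \<open>\<phi> j\<close>, so nothing arrives at position 0. In this form
  equations involving \<open>s\<close> become recursions on components.\<close>

lemma sequence_projections:
  obtains p where "\<And>j. p j \<in> Hom T P (B j)" "\<And>j. p j \<cdot> \<iota> j = ident T (B j)"
    "\<And>i j. i \<noteq> j \<Longrightarrow> p j \<cdot> \<iota> i = zarr T (B i) (B j)"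
    "p 0 \<cdot> s = zarr T P (B 0)" "\<And>j. p (Suc j) \<cdot> s = \<phi> j \<cdot> p j"
proof -
  have "B ` UNIV \<subseteq> obj T" using B_obj by blast
  then obtain p where "\<And>j. j \<in> UNIV \<Longrightarrow> p j \<in> Hom T P (B j)"
    "\<And>j. j \<in> UNIV \<Longrightarrow> p j \<cdot> \<iota> j = ident T (B j)"
    "\<And>i j. i \<in> UNIV \<Longrightarrow> j \<in> UNIV \<Longrightarrow> i \<noteq> j \<Longrightarrow> p j \<cdot> \<iota> i = zarr T (B i) (B j)"
    by (rule coproduct_projections[OF coproduct]) blast
  then have p: "\<And>j. p j \<in> Hom T P (B j)" and p1: "\<And>j. p j \<cdot> \<iota> j = ident T (B j)"
    and p0: "\<And>i j. i \<noteq> j \<Longrightarrow> p j \<cdot> \<iota> i = zarr T (B i) (B j)"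
    by simp_all
  have s\<iota>: "(p j \<cdot> s) \<cdot> \<iota> k = (p j \<cdot> \<iota> (Suc k)) \<cdot> \<phi> k" for j k
    using cmp_assoc[OF \<iota> s p] s_\<iota> cmp_assoc[OF \<phi> \<iota> p] by simp
  have "p 0 \<cdot> s = zarr T P (B 0)"
  proof (rule coproduct_map_eq[OF coproduct cmp_Hom[OF s p] zarr_Hom[OF P_obj B_obj]])
    fix k
    show "(p 0 \<cdot> s) \<cdot> \<iota> k = zarr T P (B 0) \<cdot> \<iota> k"
      using s\<iota>[of 0 k] p0[of "Suc k" 0] zarr_cmp[OF \<phi> B_obj] zarr_cmp[OF \<iota> B_obj] by simp
  qed
  moreover have "p (Suc j) \<cdot> s = \<phi> j \<cdot> p j" for j
  proof (rule coproduct_map_eq[OF coproduct cmp_Hom[OF s p] cmp_Hom[OF p \<phi>]])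
    fix k
    show "(p (Suc j) \<cdot> s) \<cdot> \<iota> k = (\<phi> j \<cdot> p j) \<cdot> \<iota> k"
    proof (cases "k = j")
      case True
      then show ?thesis
        using s\<iota>[of "Suc j" k] p1 ident_cmp[OF \<phi>[of j]] cmp_ident[OF \<phi>[of j]]
          cmp_assoc[OF \<iota> p \<phi>] by simp
    next
      case False
      then show ?thesis
        using s\<iota>[of "Suc j" k] p0 zarr_cmp[OF \<phi> B_obj] cmp_zarr[OF \<phi> B_obj]
          cmp_assoc[OF \<iota> p \<phi>] by simp
    qed
  qed
  ultimately show thesis using that p p1 p0 by blast
qed

lemma sequence_fin_comb:
  assumes "finitary U T S" "small U (UNIV :: nat set)" "f \<in> Hom T S P"
  obtains K where "fin_comb T S UNIV B P \<iota> K f"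
proof -
  have "B ` UNIV \<subseteq> obj T" using B_obj by blast
  from finitary_fin_comb[OF assms(1,2) this coproduct assms(3)] show thesis using that by blast
qed

text \<open>From \<open>d \<cdot> e = 0\<close> follows \<open>s \<cdot> e = e\<close>: the
  component at 0 vanishes and each further component is the image of the previous one, so all
  vanish. Compactness of \<open>S\<close> then yields \<open>e = 0\<close>.\<close>

lemma d_injective:
  assumes S: "finitary U T S" and U: "small U (UNIV :: nat set)"
    and e: "e \<in> Hom T S P" and de: "d \<cdot> e = zarr T S P"
  shows "e = zarr T S P"
proof -
  note So = Hom_source[OF e]
  have se: "s \<cdot> e = e" using d_cmp_add[OF e] de padd_zarr(2)[OF cmp_Hom[OF e s]] by simp
  obtain K where K: "fin_comb T S UNIV B P \<iota> K e" using sequence_fin_comb[OF S U e] by blast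
  obtain p where p: "\<And>j. p j \<in> Hom T P (B j)" and p1: "\<And>j. p j \<cdot> \<iota> j = ident T (B j)"
    and p0: "\<And>i j. i \<noteq> j \<Longrightarrow> p j \<cdot> \<iota> i = zarr T (B i) (B j)"
    and ps0: "p 0 \<cdot> s = zarr T P (B 0)" and ps: "\<And>j. p (Suc j) \<cdot> s = \<phi> j \<cdot> p j"
    using sequence_projections by blast
  have "p j \<cdot> e = zarr T S (B j)" for j
  proof (induction j)
    case 0
    have "p 0 \<cdot> e = (p 0 \<cdot> s) \<cdot> e" using cmp_assoc[OF e s p] se by simp
    then show ?case using ps0 zarr_cmp[OF e B_obj] by simp
  next
    case (Suc j)
    have "p (Suc j) \<cdot> e = (p (Suc j) \<cdot> s) \<cdot> e" using cmp_assoc[OF e s p] se by simp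
    then show ?case using ps cmp_assoc[OF e p \<phi>] Suc cmp_zarr[OF \<phi> So] by simp
  qed
  then show ?thesis using fin_comb_zero[OF K coproduct So p p1 p0] by simp
qed

lemma \<gamma>_push:
  assumes "g \<in> Hom T S (B k)" "k \<le> m"
  shows "\<exists>h \<in> Hom T S (B m). \<gamma> m \<cdot> h = \<gamma> k \<cdot> g"
  using assms(2)
proof (induction m rule: dec_induct)
  case base
  then show ?case using assms(1) by blast
next
  case (step m)
  then obtain h where h: "h \<in> Hom T S (B m)" "\<gamma> m \<cdot> h = \<gamma> k \<cdot> g" by blast
  have "\<gamma> (Suc m) \<cdot> (\<phi> m \<cdot> h) = \<gamma> k \<cdot> g"
    using cmp_assoc[OF h(1) \<phi> \<gamma>] \<gamma>_\<phi> h(2) by simp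
  then show ?case using cmp_Hom[OF h(1) \<phi>] by blast
qed

text \<open>Only finitely many stages occur in the combination, so all coefficients can be pushed to
  the largest of them and added there.\<close>

lemma factor_q:
  assumes "fin_comb T S UNIV B P \<iota> K g" and So: "S \<in> obj T"
  shows "\<exists>k. \<exists>h \<in> Hom T S (B k). \<gamma> k \<cdot> h = q \<cdot> g"
  using assms(1)
proof induction
  case empty
  have "\<gamma> 0 \<cdot> zarr T S (B 0) = q \<cdot> zarr T S P" using cmp_zarr[OF \<gamma> So] cmp_zarr[OF q So] by simp
  then show ?case using zarr_Hom[OF So B_obj] by blast
next
  case (insert K f i a)
  note a = insert.hyps(4) and f = fin_comb_Hom[OF insert.hyps(1) coproduct So]
  obtain k h where h: "h \<in> Hom T S (B k)" "\<gamma> k \<cdot> h = q \<cdot> f" using insert.IH by blast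
  obtain h' where h': "h' \<in> Hom T S (B (max i k))" "\<gamma> (max i k) \<cdot> h' = \<gamma> k \<cdot> h"
    using \<gamma>_push[OF h(1), of "max i k"] by auto
  obtain a' where a': "a' \<in> Hom T S (B (max i k))" "\<gamma> (max i k) \<cdot> a' = \<gamma> i \<cdot> a"
    using \<gamma>_push[OF a, of "max i k"] by auto
  have "\<gamma> (max i k) \<cdot> padd T a' h' = padd T (\<gamma> i \<cdot> a) (q \<cdot> f)"
    using cmp_padd_right[OF a'(1) h'(1) \<gamma>] a'(2) h'(2) h(2) by simp
  also have "\<dots> = q \<cdot> padd T (\<iota> i \<cdot> a) f"
    using cmp_padd_right[OF cmp_Hom[OF a \<iota>] f q] cmp_assoc[OF a \<iota> q] unfolding \<gamma>_def by simp
  finally show ?case using padd_Hom[OF a'(1) h'(1)] by blast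
qed

text \<open>This is surjectivity of \<open>colim Hom(S, B k) \<rightarrow> Hom(S, Q)\<close>. The
  composite \<open>r \<cdot> f\<close>, once desuspended, is killed by \<open>d\<close> and hence
  zero by \<open>d_injective\<close>, so \<open>f\<close> lifts along \<open>q\<close> to the
  coproduct.\<close>

lemma compact_factor:
  assumes S: "finitary U T S" and U: "small U (UNIV :: nat set)" and f: "f \<in> Hom T S Q"
  obtains k g where "g \<in> Hom T S (B k)" "\<gamma> k \<cdot> g = f"
proof -
  note So = Hom_source[OF f] and rf = cmp_Hom[OF f r]
  have S': "unsusp T S \<in> obj T" "susp T (unsusp T S) = S" using unsusp_obj susp_unsusp So by auto
  obtain e where e: "e \<in> Hom T (unsusp T S) P" "suspm T e = r \<cdot> f"
    using suspm_surj[of "r \<cdot> f" "unsusp T S" P] S' rf P_obj by auto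
  have "suspm T (d \<cdot> e) = (suspm T d \<cdot> r) \<cdot> f"
    using suspm_cmp[OF e(1) d] e(2) cmp_assoc[OF f r suspm_Hom[OF d]] by simp
  also have "\<dots> = zarr T S (susp T P)"
    using triangle_comp_zero'[OF triangle] zarr_cmp[OF f susp_obj[OF P_obj]] by simp
  finally have "d \<cdot> e = zarr T (unsusp T S) P" using suspm_eq_zarr[OF cmp_Hom[OF e(1) d]] S'(2) by simp
  then have "e = zarr T (unsusp T S) P" by (rule d_injective[OF finitary_unsusp[OF S] U e(1)])
  then have "r \<cdot> f = zarr T S (susp T P)" using e(2) suspm_zarr[OF S'(1) P_obj] S'(2) by simp
  then obtain g where g: "g \<in> Hom T S P" "q \<cdot> g = f"
    using weak_kernel[OF rotate[OF triangle] f] by blast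
  obtain K where "fin_comb T S UNIV B P \<iota> K g" using sequence_fin_comb[OF S U g(1)] by blast
  then show thesis using factor_q[OF _ So] g(2) that by metis
qed

text \<open>If \<open>\<gamma> k\<close> kills \<open>g\<close>, then
  \<open>\<iota> k \<cdot> g = d \<cdot> e\<close> for some \<open>e\<close>. The components of
  \<open>e\<close> vanish below \<open>k\<close> by recursion from 0. From \<open>k\<close> on each
  is the image of its predecessor under an injective map, and far out they vanish by compactness, so
  the component at \<open>k\<close> vanishes too; but that component is \<open>g\<close>.\<close>

lemma compact_injective:
  assumes S: "finitary U T S" and U: "small U (UNIV :: nat set)"
    and inj: "\<And>k g. g \<in> Hom T S (B k) \<Longrightarrow> \<phi> k \<cdot> g = zarr T S (B (Suc k)) \<Longrightarrow> g = zarr T S (B k)"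
    and g: "g \<in> Hom T S (B k)" and g0: "\<gamma> k \<cdot> g = zarr T S Q"
  shows "g = zarr T S (B k)"
proof -
  note So = Hom_source[OF g]
  have "q \<cdot> (\<iota> k \<cdot> g) = zarr T S Q" using g0 cmp_assoc[OF g \<iota> q] unfolding \<gamma>_def by simp
  then obtain e where e: "e \<in> Hom T S P" "d \<cdot> e = \<iota> k \<cdot> g"
    using weak_kernel[OF triangle cmp_Hom[OF g \<iota>]] by blast
  obtain K where K: "fin_comb T S UNIV B P \<iota> K e" using sequence_fin_comb[OF S U e(1)] by blast
  obtain p where p: "\<And>j. p j \<in> Hom T P (B j)" and p1: "\<And>j. p j \<cdot> \<iota> j = ident T (B j)"
    and p0: "\<And>i j. i \<noteq> j \<Longrightarrow> p j \<cdot> \<iota> i = zarr T (B i) (B j)"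
    and ps0: "p 0 \<cdot> s = zarr T P (B 0)" and ps: "\<And>j. p (Suc j) \<cdot> s = \<phi> j \<cdot> p j"
    using sequence_projections by blast
  have z: "zarr T S (B j) \<in> Hom T S (B j)" for j by (rule zarr_Hom[OF So B_obj])
  have pe: "padd T ((p j \<cdot> \<iota> k) \<cdot> g) ((p j \<cdot> s) \<cdot> e) = p j \<cdot> e" for j
    using cmp_padd_right[OF cmp_Hom[OF e(1) d] cmp_Hom[OF e(1) s] p[of j]] d_cmp_add[OF e(1)] e(2)
      cmp_assoc[OF g \<iota> p] cmp_assoc[OF e(1) s p] by simp
  have pe0: "p 0 \<cdot> e = zarr T S (B 0)" if "k \<noteq> 0"
    using pe[of 0] p0[of k 0] ps0 zarr_cmp[OF g B_obj] zarr_cmp[OF e(1) B_obj] padd_zarr(1)[OF z] that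
    by simp
  have pes: "p (Suc j) \<cdot> e = \<phi> j \<cdot> (p j \<cdot> e)" if "k \<noteq> Suc j" for j
    using pe[of "Suc j"] p0[of k "Suc j"] ps zarr_cmp[OF g B_obj] cmp_assoc[OF e(1) p \<phi>]
      padd_zarr(2)[OF cmp_Hom[OF cmp_Hom[OF e(1) p] \<phi>]] that by simp
  have below: "j < k \<longrightarrow> p j \<cdot> e = zarr T S (B j)" for j
  proof (induction j)
    case 0
    show ?case using pe0 by simp
  next
    case (Suc j)
    show ?case using Suc pes[of j] cmp_zarr[OF \<phi> So] by simp
  qed
  \<comment> \<open>The support of \<open>e\<close> is finite, which gives the starting point of the
    downward induction; the maximum with \<open>k\<close> keeps it from starting below
    \<open>k\<close>.\<close>
  obtain m where m: "K \<subseteq> {..<m}" using finite_nat_bounded[OF fin_comb_finite[OF K]] by blast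
  have top: "p (max k m) \<cdot> e = zarr T S (B (max k m))"
    by (rule fin_comb_projection_outside[OF K coproduct So]) (use m p p0 in auto)
  have down: "p n \<cdot> e = zarr T S (B n)" if "k \<le> n" "p (Suc n) \<cdot> e = zarr T S (B (Suc n))" for n
    using inj[OF cmp_Hom[OF e(1) p]] pes[of n] that by simp
  have "p k \<cdot> e = zarr T S (B k)"
    by (rule inc_induct[OF max.cobounded1[of k m], of "\<lambda>n. p n \<cdot> e = zarr T S (B n)"])
      (use top down in blast)+
  moreover have "(p k \<cdot> s) \<cdot> e = zarr T S (B k)"
  proof (cases k)
    case 0
    then show ?thesis using ps0 zarr_cmp[OF e(1) B_obj] by simp
  next
    case (Suc j)
    then show ?thesis using ps cmp_assoc[OF e(1) p \<phi>] below[of j] cmp_zarr[OF \<phi> So] by simp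
  qed
  ultimately show ?thesis using pe[of k] p1 ident_cmp[OF g] padd_zarr(1)[OF g] by simp
qed

end


section \<open>Torsion pairs generated by compact objects\<close>

lemma (in additive_category) coproduct_hom_vanishes:
  assumes "is_coproduct T J D C \<iota>" "Y \<in> obj T" "\<And>j. j \<in> J \<Longrightarrow> hom_vanishes T (D j) Y"
  shows "hom_vanishes T C Y"
proof -
  note C = is_coproductD(1)[OF assms(1)] and \<iota> = is_coproductD(2)[OF assms(1)]
  have "f = zarr T C Y" if f: "f \<in> Hom T C Y" for f
  proof (rule coproduct_map_eq[OF assms(1) f zarr_Hom[OF C assms(2)]])
    show "f \<cdot> \<iota> j = zarr T C Y \<cdot> \<iota> j" if "j \<in> J" for j
      using hom_vanishesD[OF assms(3)[OF that]] cmp_Hom[OF \<iota>[OF that] f]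
        zarr_cmp[OF \<iota>[OF that] assms(2)] by simp
  qed
  then show ?thesis using hom_vanishes_iff[OF C assms(2)] by blast
qed

definition right_perp :: "('o, 'm) tri_cat \<Rightarrow> 'o set \<Rightarrow> 'o set" where
  "right_perp T \<G> = {X \<in> obj T. \<forall>G \<in> \<G>. hom_vanishes T G X}"

lemma right_perpD:
  "X \<in> right_perp T \<G> \<Longrightarrow> X \<in> obj T" "X \<in> right_perp T \<G> \<Longrightarrow> G \<in> \<G> \<Longrightarrow> hom_vanishes T G X"
  unfolding right_perp_def by auto

text \<open>One step of the tower. The index set of the coproduct consists of morphisms because the
  maps to be killed index themselves; only existence of the coproduct is recorded, so that no choice
  of cone has to be carried along.\<close>

definition kills ::
  "('o, 'm) tri_cat \<Rightarrow> 'u itself \<Rightarrow> 'o set \<Rightarrow> 'o \<Rightarrow> 'o \<Rightarrow> 'm \<Rightarrow> bool" where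
  "kills T U \<G> X X' \<phi> \<longleftrightarrow> (\<exists>C c w. distinguished T C X X' c \<phi> w \<and>
     (\<exists>(J :: 'm set) D \<iota>. small U J \<and> D ` J \<subseteq> \<G> \<and> is_coproduct T J D C \<iota>) \<and>
     (\<forall>G \<in> \<G>. \<forall>f \<in> Hom T G X. cmp T \<phi> f = zarr T G X'))"

lemma killsE:
  fixes T :: "('o, 'm) tri_cat"
  assumes "kills T U \<G> X X' \<phi>"
  obtains C c w and J :: "'m set" and D \<iota> where "distinguished T C X X' c \<phi> w" "small U J" "D ` J \<subseteq> \<G>"
    "is_coproduct T J D C \<iota>"
  using assms unfolding kills_def by (elim exE conjE) (rule that)

context triangulated_category
begin

lemma ex_kills:
  assumes U: "universe U" and "has_small_coproducts U T" and \<G>: "small U \<G>" "\<G> \<subseteq> obj T"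
    and small: "\<And>G. G \<in> \<G> \<Longrightarrow> small U (Hom T G X)" and X: "X \<in> obj T"
  obtains X' \<phi> where "kills T U \<G> X X' \<phi>"
proof -
  define J where "J = (\<Union>G \<in> \<G>. Hom T G X)"
  \<comment> \<open>Distinct Hom sets are disjoint, so a morphism determines its source and the set
    \<open>J\<close> can index the family of sources.\<close>
  define D where "D f = (SOME G. f \<in> Hom T G X)" for f
  have D: "D f = G" if "f \<in> Hom T G X" for f G
    unfolding D_def by (rule some_equality) (use that Hom_disjoint in blast)+
  have J: "small U J" unfolding J_def by (rule small_UNION[OF U \<G>(1) small])
  have DJ: "D ` J \<subseteq> \<G>" unfolding J_def using D by auto
  then have "D ` J \<subseteq> obj T" using \<G>(2) by blast
  then obtain C \<iota> where C: "is_coproduct T J D C \<iota>"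
    using small_coproduct[OF assms(2) J] by blast
  have "\<forall>f \<in> J. f \<in> Hom T (D f) X" unfolding J_def using D by auto
  from ex1_implies_ex[OF coproduct_ex1[OF C X this]]
  obtain c where c: "c \<in> Hom T C X" "\<forall>f \<in> J. c \<cdot> \<iota> f = f" by blast
  obtain X' \<phi> w where t: "distinguished T C X X' c \<phi> w" using TR1_cone[OF c(1)] by blast
  note \<phi> = distinguishedD(2)[OF t]
  have "\<phi> \<cdot> f = zarr T G X'" if G: "G \<in> \<G>" and f: "f \<in> Hom T G X" for G f
  proof -
    have fJ: "f \<in> J" unfolding J_def using G f by blast
    have \<iota>: "\<iota> f \<in> Hom T G C" using is_coproductD(2)[OF C fJ] D[OF f] by simp
    have "\<phi> \<cdot> f = \<phi> \<cdot> (c \<cdot> \<iota> f)" using c(2) fJ by simp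
    also have "\<dots> = (\<phi> \<cdot> c) \<cdot> \<iota> f" using cmp_assoc[OF \<iota> c(1) \<phi>] by simp
    also have "\<dots> = zarr T G X'"
      using triangle_comp_zero[OF t] zarr_cmp[OF \<iota> Hom_target[OF \<phi>]] by simp
    finally show ?thesis .
  qed
  then have "kills T U \<G> X X' \<phi>" unfolding kills_def using t J DJ C by blast
  then show thesis by (rule that)
qed

lemma kills_Hom: "kills T U \<G> X X' \<phi> \<Longrightarrow> \<phi> \<in> Hom T X X'"
  by (erule killsE) (rule distinguishedD(2))

lemma kills_zero:
  assumes "kills T U \<G> X X' \<phi>" "G \<in> \<G>" "f \<in> Hom T G X"
  shows "\<phi> \<cdot> f = zarr T G X'"
  using assms unfolding kills_def by (elim exE conjE) simp

text \<open>The obstruction to extending \<open>a\<close> is its restriction to a coproduct of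
  members of \<open>\<G>\<close>, which has no nonzero map to \<open>B\<close>. This is the
  surjectivity along the tower that excludes phantom maps.\<close>

lemma kills_extend:
  assumes "kills T U \<G> X X' \<phi>" "B \<in> right_perp T \<G>" "a \<in> Hom T X B"
  shows "\<exists>b \<in> Hom T X' B. b \<cdot> \<phi> = a"
proof -
  obtain C c w and J :: "'b set" and D \<iota> where t: "distinguished T C X X' c \<phi> w"
    and "small U J" and J: "D ` J \<subseteq> \<G>" "is_coproduct T J D C \<iota>"
    by (rule killsE[OF assms(1)]) (rule that)
  have "hom_vanishes T C B"
    by (rule coproduct_hom_vanishes[OF J(2) right_perpD(1)[OF assms(2)]])
      (use J(1) right_perpD(2)[OF assms(2)] in blast)
  then have "a \<cdot> c = zarr T C B"
    using cmp_Hom[OF distinguishedD(1)[OF t] assms(3)] hom_vanishesD by blast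
  from weak_cokernel[OF t assms(3) this] show ?thesis by blast
qed

text \<open>A map that vanishes on \<open>X\<close> factors through the suspension of a coproduct
  from \<open>\<G>\<close>, which has no nonzero map to \<open>susp T B\<close>. Suspended targets
  are the relevant ones, as the obstructions for maps out of the fibre \<open>F\<close> lie
  there.\<close>

lemma kills_mono:
  assumes "kills T U \<G> X X' \<phi>" "B \<in> right_perp T \<G>"
    and b: "b \<in> Hom T X' (susp T B)" and "b \<cdot> \<phi> = zarr T X (susp T B)"
  shows "b = zarr T X' (susp T B)"
proof -
  obtain C c w and J :: "'b set" and D \<iota> where t: "distinguished T C X X' c \<phi> w"
    and "small U J" and J: "D ` J \<subseteq> \<G>" "is_coproduct T J D C \<iota>"
    by (rule killsE[OF assms(1)]) (rule that)
  note B = right_perpD(1)[OF assms(2)] and C = is_coproductD(1)[OF J(2)]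
  have "hom_vanishes T C B"
    by (rule coproduct_hom_vanishes[OF J(2) B]) (use J(1) right_perpD(2)[OF assms(2)] in blast)
  then have v: "hom_vanishes T (susp T C) (susp T B)" using hom_vanishes_susp[OF C B] by simp
  obtain a where a: "a \<in> Hom T (susp T C) (susp T B)" "a \<cdot> w = b"
    using weak_cokernel[OF rotate[OF t] b assms(4)] by blast
  then show ?thesis
    using hom_vanishesD[OF v a(1)] zarr_cmp[OF distinguishedD(3)[OF t] susp_obj[OF B]] by simp
qed

text \<open>By compactness every map from \<open>S\<close> to the coproduct is a finite combination
  of maps to members of \<open>\<G>\<close>.\<close>

lemma kills_cone_vanishes:
  assumes "D ` J \<subseteq> \<G>" "is_coproduct T J D C \<iota>" "small U J" "\<G> \<subseteq> obj T"
    and S: "finitary U T S" and SG: "\<And>G. G \<in> \<G> \<Longrightarrow> hom_vanishes T S G"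
  shows "hom_vanishes T S C"
proof -
  have So: "S \<in> obj T" using S unfolding finitary_def by simp
  have D: "D ` J \<subseteq> obj T" using assms by blast
  have "f = zarr T S C" if f: "f \<in> Hom T S C" for f
  proof -
    obtain K where "fin_comb T S J D C \<iota> K f"
      using finitary_fin_comb[OF S assms(3) D assms(2) f] by blast
    then show ?thesis
      by (rule fin_comb_vanishing[OF _ assms(2) So]) (use SG assms(1) in blast)
  qed
  then show ?thesis using hom_vanishes_iff[OF So is_coproductD(1)[OF assms(2)]] by blast
qed

lemma kills_inj:
  assumes "kills T U \<G> X X' \<phi>" "\<G> \<subseteq> obj T"
    and "finitary U T S" "\<And>G. G \<in> \<G> \<Longrightarrow> hom_vanishes T S G"
    and g: "g \<in> Hom T S X" and "\<phi> \<cdot> g = zarr T S X'"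
  shows "g = zarr T S X"
proof -
  obtain C c w and J :: "'b set" and D \<iota> where t: "distinguished T C X X' c \<phi> w" and J: "small U J"
    "D ` J \<subseteq> \<G>" "is_coproduct T J D C \<iota>" by (rule killsE[OF assms(1)]) (rule that)
  have v: "hom_vanishes T S C" by (rule kills_cone_vanishes[OF J(2,3,1) assms(2-4)])
  obtain a where a: "a \<in> Hom T S C" "c \<cdot> a = g" using weak_kernel[OF t g assms(6)] by blast
  then show ?thesis
    using hom_vanishesD[OF v a(1)] cmp_zarr[OF distinguishedD(1)[OF t] Hom_source[OF g]] by simp
qed

text \<open>The obstruction to lifting along \<open>\<phi>\<close> lies in
  \<open>Hom(\<Sigma>S, \<Sigma>C) = Hom(S, C) = 0\<close>. This is why surjectivity is obtained for
  \<open>susp T S\<close>, whereas \<open>kills_inj\<close> concerns \<open>S\<close>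
  itself.\<close>

lemma kills_surj:
  assumes "kills T U \<G> X X' \<phi>" "\<G> \<subseteq> obj T"
    and S: "finitary U T S" "\<And>G. G \<in> \<G> \<Longrightarrow> hom_vanishes T S G"
    and f: "f \<in> Hom T (susp T S) X'"
  shows "\<exists>g \<in> Hom T (susp T S) X. \<phi> \<cdot> g = f"
proof -
  obtain C c w and J :: "'b set" and D \<iota> where t: "distinguished T C X X' c \<phi> w" and J: "small U J"
    "D ` J \<subseteq> \<G>" "is_coproduct T J D C \<iota>" by (rule killsE[OF assms(1)]) (rule that)
  have So: "S \<in> obj T" using S unfolding finitary_def by simp
  have "hom_vanishes T S C" by (rule kills_cone_vanishes[OF J(2,3,1) assms(2-4)])
  then have "hom_vanishes T (susp T S) (susp T C)"
    using hom_vanishes_susp[OF So is_coproductD(1)[OF J(3)]] by simp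
  then have "w \<cdot> f = zarr T (susp T S) (susp T C)"
    using cmp_Hom[OF f distinguishedD(3)[OF t]] hom_vanishesD by blast
  from weak_kernel[OF rotate[OF t] f this] show ?thesis by blast
qed

lemma ex_homotopy_colimit:
  assumes U: "universe U" "has_small_coproducts U T" and \<phi>: "\<And>k. \<phi> k \<in> Hom T (B k) (B (Suc k))"
  obtains P \<iota> s d Q q r where "homotopy_colimit T B \<phi> P \<iota> s d Q q r"
proof -
  have "small U (UNIV :: nat set)" using U(1) unfolding universe_def by simp
  moreover have B: "B ` UNIV \<subseteq> obj T" using Hom_source[OF \<phi>] by blast
  ultimately obtain P \<iota> where c: "is_coproduct T UNIV B P \<iota>"
    using small_coproduct[OF U(2)] by blast
  note P = is_coproductD(1)[OF c]
  have \<iota>: "\<iota> k \<in> Hom T (B k) P" for k using is_coproductD(2)[OF c] by simp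
  have "\<forall>k \<in> UNIV. \<iota> (Suc k) \<cdot> \<phi> k \<in> Hom T (B k) P" using cmp_Hom[OF \<phi> \<iota>] by blast
  from ex1_implies_ex[OF coproduct_ex1[OF c P this]]
  obtain s where s: "s \<in> Hom T P P" "\<And>k. s \<cdot> \<iota> k = \<iota> (Suc k) \<cdot> \<phi> k" by auto
  define d where "d = padd T (ident T P) (neg P P s)"
  have d: "d \<in> Hom T P P" unfolding d_def by (rule padd_Hom[OF ident_Hom[OF P] neg_Hom[OF s(1)]])
  have ds: "padd T d s = ident T P"
    unfolding d_def using padd_assoc[OF ident_Hom[OF P] neg_Hom[OF s(1)] s(1)] padd_neg(2)[OF s(1)]
      padd_zarr(1)[OF ident_Hom[OF P]] by simp
  obtain Q q r where t: "distinguished T P P Q d q r" using TR1_cone[OF d] by blast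
  have "homotopy_colimit T B \<phi> P \<iota> s d Q q r"
    by unfold_locales (rule \<phi> c s d ds t)+
  then show thesis by (rule that)
qed

text \<open>The last conclusion allows \<open>F\<close> to be tested against compact objects other
  than those in \<open>\<G>\<close>. The t-structure depends on it, since there membership of
  \<open>F\<close> in \<open>\<Sigma>\<X>\<close> is a condition on maps into
  \<open>F\<close>.\<close>

theorem torsion_triangle:
  assumes U: "universe U" "has_small_coproducts U T" and \<G>: "small U \<G>"
    and fin: "\<And>G. G \<in> \<G> \<Longrightarrow> finitary U T G"
    and small: "\<And>G X. G \<in> \<G> \<Longrightarrow> X \<in> obj T \<Longrightarrow> small U (Hom T G X)" and X: "X \<in> obj T"
  obtains F Q u v w where "distinguished T F X Q u v w" "Q \<in> right_perp T \<G>"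
    "F \<in> left_perp T (right_perp T \<G>)"
    "\<And>S. finitary U T S \<Longrightarrow> (\<And>G. G \<in> \<G> \<Longrightarrow> hom_vanishes T S G) \<Longrightarrow> hom_vanishes T S F"
proof -
  have nat: "small U (UNIV :: nat set)" using U(1) unfolding universe_def by simp
  have \<G>o: "\<G> \<subseteq> obj T" using fin unfolding finitary_def by blast
  have ex: "\<exists>X' \<phi>. kills T U \<G> X X' \<phi>" if "X \<in> obj T" for X
    using ex_kills[OF U \<G> \<G>o small[OF _ that] that] by blast
  \<comment> \<open>The invariant carries membership in \<open>obj T\<close>, without which no next
    cone is available, and pins the initial stage to \<open>X\<close>.\<close>
  have "\<exists>B. \<forall>k. (B k \<in> obj T \<and> (k = 0 \<longrightarrow> B k = X)) \<and> (\<exists>\<phi>. kills T U \<G> (B k) (B (Suc k)) \<phi>)"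
  proof (rule dependent_nat_choice)
    show "\<exists>B. B \<in> obj T \<and> (0 = 0 \<longrightarrow> B = X)" using X by blast
    fix B and k :: nat assume "B \<in> obj T \<and> (k = 0 \<longrightarrow> B = X)"
    then obtain X' \<phi> where k: "kills T U \<G> B X' \<phi>" using ex by blast
    then have "X' \<in> obj T" using Hom_target[OF kills_Hom] by blast
    then show "\<exists>B'. (B' \<in> obj T \<and> (Suc k = 0 \<longrightarrow> B' = X)) \<and> (\<exists>\<phi>. kills T U \<G> B B' \<phi>)"
      using k by blast
  qed
  then obtain B where B0: "B 0 = X" and "\<forall>k. \<exists>\<phi>. kills T U \<G> (B k) (B (Suc k)) \<phi>" by blast
  then obtain \<phi> where k: "\<And>k. kills T U \<G> (B k) (B (Suc k)) (\<phi> k)" by metis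
  note \<phi> = kills_Hom[OF k]
  obtain P \<iota> s d Q q r where "homotopy_colimit T B \<phi> P \<iota> s d Q q r"
    using ex_homotopy_colimit[where B = B and \<phi> = \<phi>, OF U \<phi>] by blast
  then interpret H: homotopy_colimit T B \<phi> P \<iota> s d Q q r .
  note Q = Hom_target[OF H.q]
  define v where "v = H.\<gamma> 0"
  have v: "v \<in> Hom T X Q" using H.\<gamma>[of 0] B0 unfolding v_def by simp
  obtain F u w where t: "distinguished T F X Q u v w" using ex_fibre[OF v] by blast
  note u = distinguishedD(1)[OF t] and w = distinguishedD(3)[OF t]
  note F = Hom_source[OF u]
  have "hom_vanishes T G Q" if G: "G \<in> \<G>" for G
  proof -
    have Go: "G \<in> obj T" using G \<G>o by blast
    have "f = zarr T G Q" if f: "f \<in> Hom T G Q" for f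
    proof -
      obtain k g where g: "g \<in> Hom T G (B k)" "H.\<gamma> k \<cdot> g = f"
        by (rule H.compact_factor[OF fin[OF G] nat f])
      \<comment> \<open>Moved one stage further, the representative \<open>g\<close> of
        \<open>f\<close> is killed.\<close>
      have "f = H.\<gamma> (Suc k) \<cdot> (\<phi> k \<cdot> g)"
        using cmp_assoc[OF g(1) \<phi> H.\<gamma>] H.\<gamma>_\<phi>[of k] g(2) by simp
      then show ?thesis using kills_zero[OF k G g(1)] cmp_zarr[OF H.\<gamma> Go] by simp
    qed
    then show ?thesis using hom_vanishes_iff[OF Go Q] by blast
  qed
  then have Qp: "Q \<in> right_perp T \<G>" unfolding right_perp_def using Q by blast
  have FC: "hom_vanishes T F C" if C: "C \<in> right_perp T \<G>" for C
  proof -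
    note Co = right_perpD(1)[OF C]
    note ext = kills_extend[OF k C]
    have "h = zarr T F C" if h: "h \<in> Hom T F C" for h
    proof -
      \<comment> \<open>This is the obstruction to extending \<open>h\<close> from \<open>F\<close>
        to \<open>X\<close>. It vanishes on \<open>B 0\<close> because
        \<open>w \<cdot> v = 0\<close>, climbs the tower by \<open>kills_mono\<close>, and then
        vanishes on \<open>Q\<close> in the absence of phantoms.\<close>
      have hw: "suspm T h \<cdot> w \<in> Hom T Q (susp T C)" by (rule cmp_Hom[OF w suspm_Hom[OF h]])
      have hw0: "(suspm T h \<cdot> w) \<cdot> H.\<gamma> n = zarr T (B n) (susp T C)" for n
      proof (induction n)
        case 0
        have "(suspm T h \<cdot> w) \<cdot> v = suspm T h \<cdot> (w \<cdot> v)"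
          by (rule cmp_assoc[OF v w suspm_Hom[OF h]])
        then show ?case
          using triangle_comp_zero[OF rotate[OF t]] cmp_zarr[OF suspm_Hom[OF h] X] B0
          unfolding v_def by simp
      next
        case (Suc n)
        have "((suspm T h \<cdot> w) \<cdot> H.\<gamma> (Suc n)) \<cdot> \<phi> n = zarr T (B n) (susp T C)"
          using cmp_assoc[OF \<phi> H.\<gamma> hw] H.\<gamma>_\<phi>[of n] Suc by simp
        then show ?case by (rule kills_mono[OF k C cmp_Hom[OF H.\<gamma> hw]])
      qed
      have "suspm T h \<cdot> w = zarr T Q (susp T C)"
        by (rule H.no_phantoms[OF _ Co hw hw0]) (rule ext)
      \<comment> \<open>The extension \<open>y\<close> is prolonged to all stages and hence to
        \<open>Q\<close>, so \<open>h\<close> factors through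
        \<open>v \<cdot> u = 0\<close>.\<close>
      then obtain y where y: "y \<in> Hom T X C" "y \<cdot> u = h" using weak_cokernel'[OF t h] by blast
      have y0: "y \<in> Hom T (B 0) C" using y(1) B0 by simp
      obtain x where x: "\<And>k. x k \<in> Hom T (B k) C" "x 0 = y"
        "\<And>k. x (Suc k) \<cdot> \<phi> k = padd T (x k) (zarr T (B k) C)"
        using H.extend_sequence[OF ext y0, of "\<lambda>k. zarr T (B k) C"] zarr_Hom[OF H.B_obj Co] by blast
      have xx: "x (Suc k) \<cdot> \<phi> k = x k" for k using x(3) padd_zarr(1)[OF x(1)] by simp
      obtain l where l: "l \<in> Hom T Q C" "\<And>k. l \<cdot> H.\<gamma> k = x k"
        using H.weak_colimit[OF Co x(1) xx] by blast
      have "h = l \<cdot> (v \<cdot> u)"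
        using l(2)[of 0] x(2) y(2) cmp_assoc[OF u v l(1)] unfolding v_def by simp
      then show ?thesis using triangle_comp_zero[OF t] cmp_zarr[OF l(1) F] by simp
    qed
    then show ?thesis using hom_vanishes_iff[OF F Co] by blast
  qed
  then have Fp: "F \<in> left_perp T (right_perp T \<G>)" unfolding left_perp_def using F by blast
  have SF: "hom_vanishes T S F"
    if S: "finitary U T S" and SG: "\<And>G. G \<in> \<G> \<Longrightarrow> hom_vanishes T S G" for S
  proof -
    have So: "S \<in> obj T" using S unfolding finitary_def by simp
    note SSo = susp_obj[OF So]
    \<comment> \<open>Descending the tower: a map from \<open>susp T S\<close> to any stage comes
      from \<open>X\<close>, since each step is surjective on such maps.\<close>
    have lift: "\<exists>g0 \<in> Hom T (susp T S) X. v \<cdot> g0 = H.\<gamma> n \<cdot> g" if "g \<in> Hom T (susp T S) (B n)" for n g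
      using that
    proof (induction n arbitrary: g)
      case 0
      then show ?case using B0 unfolding v_def by auto
    next
      case (Suc n)
      obtain g' where g': "g' \<in> Hom T (susp T S) (B n)" "\<phi> n \<cdot> g' = g"
        using kills_surj[OF k \<G>o S SG Suc.prems] by blast
      have "H.\<gamma> (Suc n) \<cdot> g = H.\<gamma> n \<cdot> g'"
        using cmp_assoc[OF g'(1) \<phi> H.\<gamma>] H.\<gamma>_\<phi>[of n] g'(2) by simp
      then show ?case using Suc.IH[OF g'(1)] by simp
    qed
    have "e = zarr T S F" if e: "e \<in> Hom T S F" for e
    proof -
      have ue: "u \<cdot> e \<in> Hom T S (B 0)" using cmp_Hom[OF e u] B0 by simp
      have "v \<cdot> (u \<cdot> e) = zarr T S Q"
        using cmp_assoc[OF e u v] triangle_comp_zero[OF t] zarr_cmp[OF e Q] by simp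
      then have "H.\<gamma> 0 \<cdot> (u \<cdot> e) = zarr T S Q" unfolding v_def .
      then have "u \<cdot> e = zarr T S (B 0)"
        using H.compact_injective[OF S nat _ ue] kills_inj[OF k \<G>o S SG] by blast
      then have "suspm T u \<cdot> suspm T e = zarr T (susp T S) (susp T X)"
        using suspm_cmp[OF e u] suspm_zarr[OF So X] B0 by simp
      then obtain f where f: "f \<in> Hom T (susp T S) Q" "w \<cdot> f = suspm T e"
        using weak_kernel'[OF t suspm_Hom[OF e]] by blast
      obtain n g where g: "g \<in> Hom T (susp T S) (B n)" "H.\<gamma> n \<cdot> g = f"
        by (rule H.compact_factor[OF finitary_susp[OF S] nat f(1)])
      obtain g0 where g0: "g0 \<in> Hom T (susp T S) X" "v \<cdot> g0 = f" using lift[OF g(1)] g(2) by blast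
      \<comment> \<open>By exactness the suspension of \<open>e\<close> came from a map to
        \<open>Q\<close>; this map lifts to \<open>X\<close>, and \<open>w \<cdot> v = 0\<close>
        disposes of it.\<close>
      have "suspm T e = (w \<cdot> v) \<cdot> g0" using cmp_assoc[OF g0(1) v w] g0(2) f(2) by simp
      also have "\<dots> = zarr T (susp T S) (susp T F)"
        using triangle_comp_zero[OF rotate[OF t]] zarr_cmp[OF g0(1) susp_obj[OF F]] by simp
      finally show ?thesis using suspm_eq_zarr[OF e] by simp
    qed
    then show ?thesis using hom_vanishes_iff[OF So F] by blast
  qed
  show thesis by (rule that[OF t Qp Fp SF])
qed

end

section \<open>Co-t-structures and t-structures\<close>

lemma left_perp_antimono: "\<C> \<subseteq> \<B> \<Longrightarrow> left_perp T \<B> \<subseteq> left_perp T \<C>"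
  unfolding left_perp_def by auto

lemma (in additive_category) right_perp_summand_closed:
  assumes "\<G> \<subseteq> obj T"
  shows "summand_closed T (right_perp T \<G>)"
  unfolding summand_closed_def
proof (intro ballI allI impI)
  fix P X Y i j p q assume P: "P \<in> right_perp T \<G>" and "is_biproduct T X Y P i j p q"
  then have i: "i \<in> Hom T X P" and p: "p \<in> Hom T P X" and pi: "p \<cdot> i = ident T X"
    unfolding is_biproduct_def by auto
  note X = Hom_source[OF i]
  have "hom_vanishes T G X" if G: "G \<in> \<G>" for G
  proof -
    have Go: "G \<in> obj T" using G assms by blast
    have "f = zarr T G X" if f: "f \<in> Hom T G X" for f
    proof -
      have "f = p \<cdot> (i \<cdot> f)" using pi ident_cmp[OF f] cmp_assoc[OF f i p] by simp
      then show ?thesis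
        using hom_vanishesD[OF right_perpD(2)[OF P G] cmp_Hom[OF f i]] cmp_zarr[OF p Go] by simp
    qed
    then show ?thesis using hom_vanishes_iff[OF Go X] by blast
  qed
  then show "X \<in> right_perp T \<G>" unfolding right_perp_def using X by blast
qed

lemma (in additive_category) right_perp_iso_closed:
  assumes "\<G> \<subseteq> obj T"
  shows "iso_closed T (right_perp T \<G>)"
  unfolding iso_closed_def
proof (intro ballI allI impI)
  fix X Y a assume X: "X \<in> right_perp T \<G>" and "is_iso T X Y a"
  then obtain b where a: "a \<in> Hom T X Y" and b: "b \<in> Hom T Y X" and ab: "a \<cdot> b = ident T Y"
    unfolding is_iso_def by blast
  note Y = Hom_target[OF a]
  have "hom_vanishes T G Y" if G: "G \<in> \<G>" for G
  proof -
    have Go: "G \<in> obj T" using G assms by blast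
    have "f = zarr T G Y" if f: "f \<in> Hom T G Y" for f
    proof -
      have "f = a \<cdot> (b \<cdot> f)" using ab ident_cmp[OF f] cmp_assoc[OF f b a] by simp
      then show ?thesis
        using hom_vanishesD[OF right_perpD(2)[OF X G] cmp_Hom[OF f b]] cmp_zarr[OF a Go] by simp
    qed
    then show ?thesis using hom_vanishes_iff[OF Go Y] by blast
  qed
  then show "Y \<in> right_perp T \<G>" unfolding right_perp_def using Y by blast
qed

lemma (in additive_category) left_perp_summand_closed:
  assumes "\<B> \<subseteq> obj T"
  shows "summand_closed T (left_perp T \<B>)"
  unfolding summand_closed_def
proof (intro ballI allI impI)
  fix P X Y i j p q assume P: "P \<in> left_perp T \<B>" and "is_biproduct T X Y P i j p q"
  then have i: "i \<in> Hom T X P" and p: "p \<in> Hom T P X" and pi: "p \<cdot> i = ident T X"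
    unfolding is_biproduct_def by auto
  note X = Hom_source[OF i]
  have "hom_vanishes T X B" if B: "B \<in> \<B>" for B
  proof -
    have Bo: "B \<in> obj T" using B assms by blast
    have v: "hom_vanishes T P B" using P B unfolding left_perp_def by blast
    have "f = zarr T X B" if f: "f \<in> Hom T X B" for f
    proof -
      have "f = (f \<cdot> p) \<cdot> i" using pi cmp_ident[OF f] cmp_assoc[OF i p f] by simp
      then show ?thesis using hom_vanishesD[OF v cmp_Hom[OF p f]] zarr_cmp[OF i Bo] by simp
    qed
    then show ?thesis using hom_vanishes_iff[OF X Bo] by blast
  qed
  then show "X \<in> left_perp T \<B>" unfolding left_perp_def using X by blast
qed

context triangulated_category
begin

text \<open>Presenting \<open>\<A>\<close> as a left orthogonal makes its closure under summands
  automatic, and reduces its stability under desuspension to the inclusion of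
  \<open>\<Sigma>\<B>\<close> in \<open>\<B>\<close>.\<close>

lemma susp_subcat_left_perp:
  assumes "\<B> \<subseteq> obj T"
  shows "susp_subcat T (left_perp T \<B>) = left_perp T (susp T ` \<B>)"
proof -
  have "hom_vanishes T X (susp T B) \<longleftrightarrow> hom_vanishes T (unsusp T X) B" if "X \<in> obj T" "B \<in> \<B>" for X B
    using hom_vanishes_susp[of "unsusp T X" B] unsusp_obj susp_unsusp that assms by auto
  then show ?thesis unfolding susp_subcat_def left_perp_def using unsusp_obj by auto
qed

text \<open>The torsion pair is \<open>(\<Sigma>\<^sup>-\<^sup>1\<A>, \<B>)\<close>. Stability of
  \<open>\<B>\<close> under suspension turns into stability of \<open>\<A>\<close> under
  desuspension because left orthogonals reverse inclusions.\<close>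

theorem compactly_generated_co_t_structure:
  assumes U: "universe U" "has_small_coproducts U T" and \<G>: "small U \<G>"
    and fin: "\<And>G. G \<in> \<G> \<Longrightarrow> finitary U T G"
    and small: "\<And>G X. G \<in> \<G> \<Longrightarrow> X \<in> obj T \<Longrightarrow> small U (Hom T G X)"
    and susp: "susp T ` right_perp T \<G> \<subseteq> right_perp T \<G>"
  shows "co_t_structure T (susp_subcat T (left_perp T (right_perp T \<G>))) (right_perp T \<G>)"
proof -
  let ?B = "right_perp T \<G>" and ?A = "susp_subcat T (left_perp T (right_perp T \<G>))"
  have \<G>o: "\<G> \<subseteq> obj T" using fin unfolding finitary_def by blast
  have Bo: "?B \<subseteq> obj T" unfolding right_perp_def by blast
  have Ao: "?A \<subseteq> obj T" unfolding susp_subcat_def by blast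
  have A: "?A = left_perp T (susp T ` ?B)" by (rule susp_subcat_left_perp[OF Bo])
  have SBo: "susp T ` ?B \<subseteq> obj T" using Bo susp by blast
  have unsusp: "unsusp T X \<in> ?A" if "X \<in> ?A" for X
  proof -
    have "unsusp T X \<in> left_perp T ?B" using that unfolding susp_subcat_def by blast
    then show ?thesis unfolding A using left_perp_antimono[OF susp] by blast
  qed
  have orth: "hom_vanishes T (unsusp T X) B" if "X \<in> ?A" "B \<in> ?B" for X B
    using that unfolding susp_subcat_def left_perp_def by blast
  have triangle: "\<exists>X \<in> ?A. \<exists>B \<in> ?B. \<exists>u v w. w \<in> Hom T B X \<and> distinguished T (unsusp T X) Z B u v w"
    if Z: "Z \<in> obj T" for Z
  proof -
    obtain F Q u v w where t: "distinguished T F Z Q u v w" and Q: "Q \<in> ?B"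
      and F: "F \<in> left_perp T ?B"
      by (rule torsion_triangle[OF U \<G> _ _ Z], erule fin, erule (1) small, rule that)
    have Fo: "F \<in> obj T" using F unfolding left_perp_def by blast
    \<comment> \<open>The required triangle begins with the desuspension of an object of
      \<open>\<A>\<close>, so that object is \<open>susp T F\<close>; the connecting map then has
      the right target.\<close>
    have "susp T F \<in> ?A" unfolding susp_subcat_def using F susp_obj[OF Fo] unsusp_susp[OF Fo] by simp
    then show ?thesis using Q t distinguishedD(3)[OF t] unsusp_susp[OF Fo] by metis
  qed
  have "summand_closed T ?A" unfolding A by (rule left_perp_summand_closed[OF SBo])
  then show ?thesis
    unfolding co_t_structure_def
    by (intro conjI ballI image_subsetI Ao Bo susp unsusp orth triangle
        right_perp_summand_closed[OF \<G>o])
qed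

lemma exact_vanishing:
  assumes t: "distinguished T X Y Z u v w" and S: "S \<in> obj T"
    and "hom_vanishes T S Y" "hom_vanishes T S (susp T X)"
  shows "hom_vanishes T S Z"
proof -
  note v = distinguishedD(2)[OF t] and w = distinguishedD(3)[OF t]
  have "f = zarr T S Z" if f: "f \<in> Hom T S Z" for f
  proof -
    have "w \<cdot> f = zarr T S (susp T X)" by (rule hom_vanishesD[OF assms(4) cmp_Hom[OF f w]])
    then obtain g where "g \<in> Hom T S Y" "v \<cdot> g = f" using weak_kernel[OF rotate[OF t] f] by blast
    then show ?thesis using hom_vanishesD[OF assms(3)] cmp_zarr[OF v S] by metis
  qed
  then show ?thesis using hom_vanishes_iff[OF S Hom_target[OF v]] by blast
qed

section \<open>Transport of smallness and vanishing along shifts\<close>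

lemma small_Hom_susp:
  assumes "X \<in> obj T" "Y \<in> obj T"
  shows "small U (Hom T (susp T X) (susp T Y)) \<longleftrightarrow> small U (Hom T X Y)"
proof -
  note b = suspm_bij[OF assms]
  show ?thesis
    using small_image[of U "Hom T X Y" "suspm T"]
      small_image[of U "Hom T (susp T X) (susp T Y)" "inv_into (Hom T X Y) (suspm T)"]
      bij_betw_imp_surj_on[OF b] bij_betw_imp_surj_on[OF bij_betw_inv_into[OF b]] by auto
qed

lemma small_Hom_shift:
  assumes "X \<in> obj T" "Y \<in> obj T"
  shows "small U (Hom T (shift T k X) (shift T k Y)) \<longleftrightarrow> small U (Hom T X Y)"
proof (induction k rule: int_induct[where k = 0])
  case base
  then show ?case by (simp add: shift_0)
next
  case (step1 i)
  then show ?case using small_Hom_susp[of "shift T i X" "shift T i Y" U] shift_obj assms by (simp add: shift_plus1)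
next
  case (step2 i)
  then show ?case
    using small_Hom_susp[of "shift T (i - 1) X" "shift T (i - 1) Y" U] shift_obj assms
      shift_plus1[of _ "i - 1"] by simp
qed

text \<open>Shifting both arguments by \<open>- k\<close> identifies this Hom set with one out of
  \<open>S\<close>, to which the smallness hypothesis on the compact objects applies.\<close>

lemma small_Hom_from_shift:
  assumes "S \<in> obj T" "X \<in> obj T" "\<And>Y. Y \<in> obj T \<Longrightarrow> small U (Hom T S Y)"
  shows "small U (Hom T (shift T k S) X)"
  using small_Hom_shift[OF assms(1) shift_obj[OF assms(2), of "- k"], of U k]
    assms(3)[OF shift_obj[OF assms(2), of "- k"]] shift_add[OF assms(2), of k "- k"]
  by (simp add: shift_0)

lemma hom_vanishes_from_shift:
  assumes "X \<in> obj T" "Y \<in> obj T"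
  shows "hom_vanishes T (shift T n X) Y \<longleftrightarrow> hom_vanishes T X (shift T (- n) Y)"
  using hom_vanishes_shift_iff[OF assms, of n 0] by (simp add: shift_0)

text \<open>
  With \<open>\<G>\<close> the positive shifts of \<open>\<S>\<close> the class \<open>\<Y>\<close> is \<open>\<G>\<^sup>\<bottom>\<close>.  The first term of a torsion
  triangle lies in \<open>\<Sigma>\<X>\<close> because all of \<open>\<G>\<close> does.  If the middle term lies in \<open>\<Sigma>\<X>\<close>,
  then the third one has no maps from any shift of \<open>\<S>\<close>, hence is zero.
\<close>

theorem silting_t_structure:
  fixes \<S> :: "'a set"
  assumes U: "universe U" "has_small_coproducts U T"
    and cpt: "\<And>S. S \<in> \<S> \<Longrightarrow> finitary U T S"
    and small: "\<And>S X. S \<in> \<S> \<Longrightarrow> X \<in> obj T \<Longrightarrow> small U (Hom T S X)"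
    and silting: "\<And>S S' i. S \<in> \<S> \<Longrightarrow> S' \<in> \<S> \<Longrightarrow> i > 0 \<Longrightarrow> hom_vanishes T S (shift T i S')"
    and gen: "generating_set U T {shift T i S | i S. S \<in> \<S>}"
  defines "\<X> \<equiv> {X \<in> obj T. \<forall>S \<in> \<S>. \<forall>i > 0. hom_vanishes T S (shift T i X)}"
    and "\<Y> \<equiv> {X \<in> obj T. \<forall>S \<in> \<S>. \<forall>i < 0. hom_vanishes T S (shift T i X)}"
  shows "t_structure T \<X> \<Y>"
proof -
  have So: "S \<in> obj T" if "S \<in> \<S>" for S using cpt[OF that] unfolding finitary_def by simp
  define \<G> where "\<G> = {shift T i S | i S. i > 0 \<and> S \<in> \<S>}"
  \<comment> \<open>As the right orthogonal of the negative shifts, \<open>\<X>\<close> is closed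
    under isomorphism for free.\<close>
  define \<H> where "\<H> = {shift T i S | i S. i < 0 \<and> S \<in> \<S>}"
  have \<G>o: "\<G> \<subseteq> obj T" and \<H>o: "\<H> \<subseteq> obj T" unfolding \<G>_def \<H>_def using So shift_obj by blast+
  have \<Y>: "\<Y> = right_perp T \<G>"
  proof -
    have "(\<forall>S \<in> \<S>. \<forall>i < 0. hom_vanishes T S (shift T i X)) \<longleftrightarrow> (\<forall>G \<in> \<G>. hom_vanishes T G X)"
      if X: "X \<in> obj T" for X
    proof -
      have "(\<forall>G \<in> \<G>. hom_vanishes T G X) \<longleftrightarrow> (\<forall>S \<in> \<S>. \<forall>i > 0. hom_vanishes T S (shift T (- i) X))"
        unfolding \<G>_def using hom_vanishes_from_shift[OF So X] by blast
      then show ?thesis by (metis minus_minus neg_0_less_iff_less neg_less_0_iff_less)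
    qed
    then show ?thesis unfolding \<Y>_def right_perp_def by blast
  qed
  have \<X>: "\<X> = right_perp T \<H>"
  proof -
    have "(\<forall>S \<in> \<S>. \<forall>i > 0. hom_vanishes T S (shift T i X)) \<longleftrightarrow> (\<forall>G \<in> \<H>. hom_vanishes T G X)"
      if X: "X \<in> obj T" for X
    proof -
      have "(\<forall>G \<in> \<H>. hom_vanishes T G X) \<longleftrightarrow> (\<forall>S \<in> \<S>. \<forall>i < 0. hom_vanishes T S (shift T (- i) X))"
        unfolding \<H>_def using hom_vanishes_from_shift[OF So X] by blast
      then show ?thesis by (metis minus_minus neg_0_less_iff_less neg_less_0_iff_less)
    qed
    then show ?thesis unfolding \<X>_def right_perp_def by blast
  qed
  have "\<G> \<subseteq> {shift T i S | i S. S \<in> \<S>}" unfolding \<G>_def by blast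
  moreover have "small U {shift T i S | i S. S \<in> \<S>}" using gen unfolding generating_set_def by simp
  ultimately have \<G>: "small U \<G>" using small_subset by blast
  have fin: "finitary U T G" if "G \<in> \<G>" for G
    using that finitary_shift[OF cpt] unfolding \<G>_def by blast
  have smallG: "small U (Hom T G X)" if "G \<in> \<G>" "X \<in> obj T" for G X
    using that small_Hom_from_shift[OF So _ small] unfolding \<G>_def by blast
  \<comment> \<open>Orthogonality to all of \<open>\<Y>\<close> is recorded for this particular
    first term, because for general objects of \<open>\<X>\<close> it is derived from this
    case.\<close>
  have torsion: "\<exists>X \<in> \<X>. \<exists>Y \<in> \<Y>. \<exists>u v w. distinguished T (susp T X) Z Y u v w \<and>
      (\<forall>Y' \<in> \<Y>. hom_vanishes T (susp T X) Y')" if Z: "Z \<in> obj T" for Z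
  proof -
    obtain F Q u v w where t: "distinguished T F Z Q u v w" and Q: "Q \<in> right_perp T \<G>"
      and F: "F \<in> left_perp T (right_perp T \<G>)"
      and SF: "\<And>S. finitary U T S \<Longrightarrow> (\<And>G. G \<in> \<G> \<Longrightarrow> hom_vanishes T S G) \<Longrightarrow> hom_vanishes T S F"
      using torsion_triangle[OF U \<G> fin smallG Z] by blast
    have Fo: "F \<in> obj T" using F unfolding left_perp_def by blast
    define X where "X = unsusp T F"
    have X: "X \<in> obj T" "susp T X = F" unfolding X_def using unsusp_obj susp_unsusp Fo by auto
    have "hom_vanishes T S (shift T i X)" if S: "S \<in> \<S>" and i: "i > 0" for S i
    proof -
      \<comment> \<open>With \<open>F = \<Sigma>X\<close> the maps from \<open>S\<close> to
        \<open>\<Sigma>\<^sup>iX\<close> are those from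
        \<open>\<Sigma>\<^sup>1\<^sup>-\<^sup>iS\<close> to \<open>F\<close>. For
        \<open>j > 0\<close> the difference of degrees \<open>j + i - 1\<close> is positive, so
        hypothesis (1) applies.\<close>
      have "hom_vanishes T (shift T (1 - i) S) F"
      proof (rule SF[OF finitary_shift[OF cpt[OF S]]])
        fix G assume "G \<in> \<G>"
        then obtain j S' where G: "G = shift T j S'" "j > 0" "S' \<in> \<S>" unfolding \<G>_def by blast
        have "j - (1 - i) > 0" using G(2) i by simp
        then show "hom_vanishes T (shift T (1 - i) S) G"
          using hom_vanishes_shift_iff[OF So[OF S] So[OF G(3)], of "1 - i" j]
            silting[OF S G(3)] G(1) by simp
      qed
      then show ?thesis
        using hom_vanishes_shift_iff[OF So[OF S] X(1), of "1 - i" 1] X(2) by (simp add: shift_1)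
    qed
    then have "X \<in> \<X>" unfolding \<X>_def using X(1) by blast
    moreover have "\<forall>Y' \<in> \<Y>. hom_vanishes T (susp T X) Y'"
      using F X(2) unfolding \<Y> left_perp_def by blast
    ultimately show ?thesis using t Q X(2) \<Y> by metis
  qed
  \<comment> \<open>The object \<open>\<Sigma>X\<close> is itself decomposed. Its third term turns
    out to be zero, so every map to \<open>\<Y>\<close> is determined by its restriction to the
    first term, for which orthogonality is known.\<close>
  have orth: "hom_vanishes T (susp T X) Y" if X: "X \<in> \<X>" and Y: "Y \<in> \<Y>" for X Y
  proof -
    have Xo: "X \<in> obj T" and Yo: "Y \<in> obj T" using X Y unfolding \<X>_def \<Y>_def by blast+
    note SX = susp_obj[OF Xo]
    obtain X' Y' u v w where X': "X' \<in> \<X>" and Y': "Y' \<in> \<Y>"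
      and t: "distinguished T (susp T X') (susp T X) Y' u v w"
      and van: "\<forall>Y' \<in> \<Y>. hom_vanishes T (susp T X') Y'"
      using torsion[OF SX] by blast
    have X'o: "X' \<in> obj T" and Y'o: "Y' \<in> obj T" using X' Y' unfolding \<X>_def \<Y>_def by blast+
    have "hom_vanishes T (shift T j S) Y'" if S: "S \<in> \<S>" for j S
    proof (cases "j > 0")
      case True
      then have "shift T j S \<in> \<G>" unfolding \<G>_def using S by blast
      then show ?thesis by (rule right_perpD(2)[OF Y'[unfolded \<Y>]])
    next
      case False
      show ?thesis
      proof (rule exact_vanishing[OF t shift_obj[OF So[OF S]]])
        \<comment> \<open>For \<open>j \<le> 0\<close> the degrees \<open>1 - j\<close> and
          \<open>2 - j\<close> are positive; they belong to the middle term \<open>\<Sigma>X\<close>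
          and to the suspended first term \<open>\<Sigma>\<^sup>2X'\<close>.\<close>
        have "hom_vanishes T S (shift T (1 - j) X)" "hom_vanishes T S (shift T (2 - j) X')"
          using X X' S False unfolding \<X>_def by auto
        then show "hom_vanishes T (shift T j S) (susp T X)"
          "hom_vanishes T (shift T j S) (susp T (susp T X'))"
          using hom_vanishes_shift_iff[OF So[OF S] Xo, of j 1] shift_1
            hom_vanishes_shift_iff[OF So[OF S] X'o, of j 2] shift_plus1[OF X'o, of 1] by simp_all
      qed
    qed
    then have "is_zero T Y'" using gen Y'o unfolding generating_set_def by blast
    note zero = zero_object_Hom[OF this]
    have "f = zarr T (susp T X) Y" if f: "f \<in> Hom T (susp T X) Y" for f
    proof -
      note u = distinguishedD(1)[OF t] and v = distinguishedD(2)[OF t]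
      have "f \<cdot> u = zarr T (susp T X') Y" using hom_vanishesD van Y cmp_Hom[OF u f] by blast
      then obtain g where "g \<in> Hom T Y' Y" "g \<cdot> v = f" using weak_cokernel[OF t f] by blast
      then show ?thesis using zero(2) zarr_cmp[OF v Yo] by metis
    qed
    then show ?thesis using hom_vanishes_iff[OF SX Yo] by blast
  qed
  have susp: "susp T X \<in> \<X>" if "X \<in> \<X>" for X
  proof -
    have X: "X \<in> obj T" using that unfolding \<X>_def by blast
    have "hom_vanishes T S (shift T i (susp T X))" if "S \<in> \<S>" "i > 0" for S i
      using that \<open>X \<in> \<X>\<close> shift_add[OF X, of i 1] unfolding \<X>_def by (simp add: shift_1)
    then show ?thesis unfolding \<X>_def using susp_obj[OF X] by blast
  qed
  have unsusp: "unsusp T Y \<in> \<Y>" if "Y \<in> \<Y>" for Y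
  proof -
    have Y: "Y \<in> obj T" using that unfolding \<Y>_def by blast
    have "hom_vanishes T S (shift T i (unsusp T Y))" if "S \<in> \<S>" "i < 0" for S i
      using that \<open>Y \<in> \<Y>\<close> shift_add[OF Y, of i "- 1"] unfolding \<Y>_def by (simp add: shift_neg1)
    then show ?thesis unfolding \<Y>_def using unsusp_obj[OF Y] by blast
  qed
  have iso: "iso_closed T \<X>" "iso_closed T \<Y>"
    unfolding \<X> \<Y> using right_perp_iso_closed \<G>o \<H>o by blast+
  have sub: "\<X> \<subseteq> obj T" "\<Y> \<subseteq> obj T" unfolding \<X>_def \<Y>_def by blast+
  have triangle: "\<exists>X \<in> \<X>. \<exists>Y \<in> \<Y>. \<exists>u v w. distinguished T (susp T X) Z Y u v w"
    if "Z \<in> obj T" for Z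
    using torsion[OF that] by blast
  show ?thesis
    unfolding t_structure_def
    by (intro conjI ballI image_subsetI sub iso susp unsusp orth triangle)
qed

end

text \<open>The defining conditions of \<open>\<B>\<close> and \<open>\<X>\<close> coincide, so
  adjacency reduces to the two pairs being a co-t-structure and a t-structure.\<close>

theorem corollary7:
  fixes T :: "('o, 'm) tri_cat"
    and U :: "'u itself"
    and \<S> \<A> \<B> \<X> \<Y> :: "'o set"
  assumes "universe U"
    and "triangulated_category T"
    and "has_small_coproducts U T"
    and "small U \<S>"
    and "\<forall>S \<in> \<S>. compact_object U T S"
    and "\<forall>S \<in> \<S>. \<forall>X \<in> obj T. small U (Hom T S X)"
    and "\<forall>S \<in> \<S>. \<forall>S' \<in> \<S>. \<forall>i :: int. i > 0 \<longrightarrow> hom_vanishes T S (shift T i S')"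
    and "generating_set U T {shift T i S | i S. S \<in> \<S>}"
    and "\<B> = {X \<in> obj T. \<forall>S \<in> \<S>. \<forall>n :: int. n > 0 \<longrightarrow> hom_vanishes T S (shift T n X)}"
    and "\<A> = susp_subcat T (left_perp T \<B>)"
    and "\<X> = {X \<in> obj T. \<forall>S \<in> \<S>. \<forall>i :: int. i > 0 \<longrightarrow> hom_vanishes T S (shift T i X)}"
    and "\<Y> = {X \<in> obj T. \<forall>S \<in> \<S>. \<forall>i :: int. i < 0 \<longrightarrow> hom_vanishes T S (shift T i X)}"
  shows "left_adjacent T (\<A>, \<B>) (\<X>, \<Y>)"
proof -
  interpret triangulated_category T by (rule assms(2))
  have cpt: "finitary U T S" if "S \<in> \<S>" for S using compact_finitary assms(5) that by blast
  have So: "S \<in> obj T" if "S \<in> \<S>" for S using cpt[OF that] unfolding finitary_def by simp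
  have t: "t_structure T \<X> \<Y>"
    unfolding assms(11,12)
    by (rule silting_t_structure[OF assms(1,3) cpt _ _ assms(8)]) (use assms(6,7) in blast)+
  \<comment> \<open>Maps from \<open>S\<close> to \<open>\<Sigma>\<^sup>nX\<close> are maps from
    \<open>\<Sigma>\<^sup>-\<^sup>nS\<close> to \<open>X\<close>; with the negative shifts as test
    objects, \<open>\<B>\<close> is a right orthogonal.\<close>
  define \<H> where "\<H> = {shift T i S | i S. i < 0 \<and> S \<in> \<S>}"
  have "(\<forall>S \<in> \<S>. \<forall>n > 0. hom_vanishes T S (shift T n X)) \<longleftrightarrow> (\<forall>G \<in> \<H>. hom_vanishes T G X)"
    if X: "X \<in> obj T" for X
  proof -
    have "(\<forall>G \<in> \<H>. hom_vanishes T G X) \<longleftrightarrow> (\<forall>S \<in> \<S>. \<forall>i < 0. hom_vanishes T S (shift T (- i) X))"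
      unfolding \<H>_def using hom_vanishes_from_shift[OF So X] by blast
    then show ?thesis by (metis minus_minus neg_0_less_iff_less neg_less_0_iff_less)
  qed
  then have \<B>: "\<B> = right_perp T \<H>" unfolding assms(9) right_perp_def by blast
  have "\<H> \<subseteq> {shift T i S | i S. S \<in> \<S>}" unfolding \<H>_def by blast
  moreover have "small U {shift T i S | i S. S \<in> \<S>}" using assms(8) unfolding generating_set_def by simp
  ultimately have "small U \<H>" using small_subset by blast
  moreover have "finitary U T G" if "G \<in> \<H>" for G
    using that finitary_shift[OF cpt] unfolding \<H>_def by blast
  moreover have "small U (Hom T G X)" if "G \<in> \<H>" "X \<in> obj T" for G X
    using that small_Hom_from_shift[OF So, where U = U] assms(6) unfolding \<H>_def by blast
  moreover have "\<B> = \<X>" unfolding assms(9,11) by simp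
  \<comment> \<open>The stability that the co-t-structure needs is inherited from the t-structure
    already constructed.\<close>
  moreover have "susp T ` \<B> \<subseteq> \<B>" using t \<open>\<B> = \<X>\<close> unfolding t_structure_def by simp
  ultimately have "co_t_structure T \<A> \<B>"
    using compactly_generated_co_t_structure[OF assms(1,3), of \<H>] unfolding assms(10) \<B> by blast
  then show ?thesis using t \<open>\<B> = \<X>\<close> unfolding left_adjacent_def by simp
qed

end
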